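(* There exists a distance-approximation algorithm for chordality whose query complexity is $\mathrm{poly}(1/\varepsilon)$.
   Context: A graph is chordal if every cycle of length greater than three in it has a chord (an edge between two non-consecutive vertices of the cycle), equivalently it has no induced cycle $C_\ell$ with $\ell>3$. Graphs are finite, simple, undirected, with $n$ vertices. The distance between $G=(V,E)$ and $G'=(V,E')$ is $\Delta(G,G')=(|E\setminus E'|+|E'\setminus E|)/n^2$, and $\Delta(G,\mathcal{P})=\min_{G'\in\mathcal{P}}\Delta(G,G')$. A distance-approximation algorithm for a property $\mathcal{P}$ is a randomized algorithm that, for every graph $G$ and every $\varepsilon\in(0,1)$, given $\varepsilon$ and query access to the adjacency matrix of $G$, outputs $\hat\Delta$ with $|\hat\Delta-\Delta(G,\mathcal{P})|\le\varepsilon$ with probability at least $2/3$; its query complexity is the number of adjacency queries. *)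

theory Defs
  imports "HOL-Probability.Probability" "HOL-Computational_Algebra.Polynomial"
begin

text \<open>
  A finite simple graph on \<open>n\<close> vertices has vertex set \<open>{..<n}\<close> (the index set of its adjacency
  matrix) and is given by its set of edges, which are two-element sets of vertices.
\<close>

definition simple_graph :: "nat \<Rightarrow> nat set set \<Rightarrow> bool" where
  "simple_graph n E \<longleftrightarrow> (\<forall>e\<in>E. e \<subseteq> {..<n} \<and> card e = 2)"

text \<open>
  A cycle is the list of its pairwise distinct vertices; the vertex following the last one is
  the first one.
\<close>

definition is_cycle :: "'a set set \<Rightarrow> 'a list \<Rightarrow> bool" where
  "is_cycle E c \<longleftrightarrow> length c \<ge> 3 \<and> distinct c \<and>
     (\<forall>i<length c. {c ! i, c ! (Suc i mod length c)} \<in> E)"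

definition has_chord :: "'a set set \<Rightarrow> 'a list \<Rightarrow> bool" where
  "has_chord E c \<longleftrightarrow> (\<exists>i<length c. \<exists>j<length c. i \<noteq> j \<and>
     j \<noteq> Suc i mod length c \<and> i \<noteq> Suc j mod length c \<and> {c ! i, c ! j} \<in> E)"

definition chordal :: "'a set set \<Rightarrow> bool" where
  "chordal E \<longleftrightarrow> (\<forall>c. is_cycle E c \<and> length c > 3 \<longrightarrow> has_chord E c)"

definition graph_dist :: "nat \<Rightarrow> nat set set \<Rightarrow> nat set set \<Rightarrow> real" where
  "graph_dist n E E' = real (card (E - E') + card (E' - E)) / real n ^ 2"

text \<open>
  A graph property \<open>P\<close> is a predicate on the number of vertices and the edge set. The minimum
  ranges over a finite set; it is meaningful only if some graph on \<open>n\<close> vertices satisfies \<open>P\<close>,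
  as is the case for chordality (witnessed by the edgeless graph).
\<close>

definition dist_to_property :: "nat \<Rightarrow> nat set set \<Rightarrow> (nat \<Rightarrow> nat set set \<Rightarrow> bool) \<Rightarrow> real" where
  "dist_to_property n E P = Min (graph_dist n E ` {E'. simple_graph n E' \<and> P n E'})"

text \<open>
  Deterministic adaptive algorithms with real output are decision trees: \<open>Query u v k\<close> asks
  whether \<open>u\<close> and \<open>v\<close> are adjacent and continues with \<open>k b\<close>, where \<open>b\<close> is the answer. Queries
  outside of \<open>{..<n}\<close> are answered \<open>False\<close> and hence carry no information (they still count).
\<close>

datatype decision_tree = Output real | Query nat nat "bool \<Rightarrow> decision_tree"

definition adjacent :: "'a set set \<Rightarrow> 'a \<Rightarrow> 'a \<Rightarrow> bool" where
  "adjacent E u v \<longleftrightarrow> {u, v} \<in> E"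

primrec run :: "(nat \<Rightarrow> nat \<Rightarrow> bool) \<Rightarrow> decision_tree \<Rightarrow> real" where
  "run adj (Output r) = r"
| "run adj (Query u v k) = run adj (k (adj u v))"

primrec num_queries :: "(nat \<Rightarrow> nat \<Rightarrow> bool) \<Rightarrow> decision_tree \<Rightarrow> nat" where
  "num_queries adj (Output r) = 0"
| "num_queries adj (Query u v k) = Suc (num_queries adj (k (adj u v)))"

text \<open>
  A randomized algorithm receives the accuracy parameter and the number of vertices (the dimension
  of the adjacency matrix). Fixing its random choices leaves a deterministic algorithm, so it is
  a probability distribution on decision trees.
\<close>

type_synonym randomized_algorithm = "real \<Rightarrow> nat \<Rightarrow> decision_tree pmf"

definition distance_approximation_algorithm ::
  "(nat \<Rightarrow> nat set set \<Rightarrow> bool) \<Rightarrow> randomized_algorithm \<Rightarrow> bool" where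
  "distance_approximation_algorithm P A \<longleftrightarrow>
     (\<forall>n E \<epsilon>. simple_graph n E \<and> 0 < \<epsilon> \<and> \<epsilon> < 1 \<longrightarrow>
        measure_pmf.prob (A \<epsilon> n)
          {t. \<bar>run (adjacent E) t - dist_to_property n E P\<bar> \<le> \<epsilon>} \<ge> 2 / 3)"

text \<open>
  The query complexity is worst case over all graphs of all sizes and all random choices; the
  bound \<open>q\<close> depends on \<open>\<epsilon>\<close> only.
\<close>

definition query_complexity_at_most :: "randomized_algorithm \<Rightarrow> (real \<Rightarrow> real) \<Rightarrow> bool" where
  "query_complexity_at_most A q \<longleftrightarrow>
     (\<forall>n E \<epsilon>. simple_graph n E \<and> 0 < \<epsilon> \<and> \<epsilon> < 1 \<longrightarrow>
        (\<forall>t\<in>set_pmf (A \<epsilon> n). real (num_queries (adjacent E) t) \<le> q \<epsilon>))"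

end

theory Submission
  imports Defs
begin

text \<open>
  The edges between a clique and an independent set are unconstrained in a split graph, so chordal
  graphs are not close to intersection graphs of subtrees of a small tree. They are if such free
  pairs are allowed. Represent a chordal graph by subtrees \<open>T\<^sub>v\<close> of a rooted forest on its vertices, using
  a perfect elimination order. A set \<open>S\<close> of \<open>poly(1/\<epsilon>)\<close> nodes can be chosen such that, after deleting at
  most \<open>\<epsilon> n\<^sup>2\<close> edges, two vertices whose subtrees meet \<open>S\<close> are adjacent iff their subtrees meet inside \<open>S\<close>,
  and every other vertex is attached to one node \<open>s\<close> of \<open>S\<close> and has only neighbours whose subtrees
  contain \<open>s\<close>. Conversely, every graph of this kind is chordal, whatever these neighbourhoods are.
  Hence the distance to chordality is, up to \<open>\<epsilon>\<close>, the minimum of a dense cost function with binary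
  interactions over the assignments of \<open>exp(poly(1/\<epsilon>))\<close> many types to the vertices.

  Such a minimum is estimated as in the partition algorithm of Goldreich, Goldwasser and Ron. The
  vertices are split into \<open>O(1/\<epsilon>)\<close> cells; starting from an optimal assignment, the cells are reassigned
  one after the other, each vertex taking the type of least cost as estimated from a random sample
  whose current types are guessed. This changes the cost by \<open>O(\<epsilon> n\<^sup>2)\<close>, and the final assignment is
  determined by the samples and the guesses. By Hoeffding's inequality, \<open>poly(1/\<epsilon>)\<close> random pairs estimate
  the cost of the assignments for all guesses simultaneously.
\<close>

section \<open>Elimination orders of chordal graphs\<close>

text \<open>On a cycle take a vertex of maximal rank. Its two cyclic neighbours, at positions
  \<open>j\<close> and \<open>k\<close>, have no larger rank, so they are adjacent, and on more than
  three vertices this edge is a chord. Ties in \<open>\<rho>\<close> are allowed, since later the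
  rank is the root of a subtree, which many vertices may share.\<close>

lemma chordal_rankI:
  fixes \<rho> :: "'a \<Rightarrow> nat"
  assumes clique: "\<And>v x y. {v, x} \<in> E \<Longrightarrow> {v, y} \<in> E \<Longrightarrow> x \<noteq> y \<Longrightarrow> \<rho> x \<le> \<rho> v \<Longrightarrow> \<rho> y \<le> \<rho> v \<Longrightarrow> {x, y} \<in> E"
  shows "chordal E"
  unfolding chordal_def
proof (intro allI impI, elim conjE)
  fix c assume c: "is_cycle E c" and l: "length c > 3"
  let ?l = "length c"
  have "finite {..<?l}" "{..<?l} \<noteq> {}" using l by (auto simp: lessThan_empty_iff)
  then obtain i where i: "i < ?l" and max: "\<And>j. j < ?l \<Longrightarrow> \<rho> (c ! j) \<le> \<rho> (c ! i)"
    using Max_in[of "(\<lambda>j. \<rho> (c ! j)) ` {..<?l}"] Max_ge[of "(\<lambda>j. \<rho> (c ! j)) ` {..<?l}"]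
    by (smt (verit) finite_imageI image_iff image_is_empty lessThan_iff)
  define j where "j = (if i = 0 then ?l - 1 else i - 1)"
  define k where "k = Suc i mod ?l"
  have k_cases: "k = (if Suc i = ?l then 0 else Suc i)"
    using i by (auto simp: k_def)
  have jl: "j < ?l" and kl: "k < ?l" and jk: "j \<noteq> k"
    using i l by (auto simp: j_def k_cases)
  have sj: "Suc j mod ?l = i" using i l by (auto simp: j_def)
  have edges: "\<And>i. i < ?l \<Longrightarrow> {c ! i, c ! (Suc i mod ?l)} \<in> E" and "distinct c"
    using c by (auto simp: is_cycle_def)
  have "{c ! i, c ! j} \<in> E" using edges[OF jl] sj by (simp add: insert_commute)
  moreover have "{c ! i, c ! k} \<in> E" using edges[OF i] k_def by simp
  moreover have "c ! j \<noteq> c ! k" using \<open>distinct c\<close> jl kl jk by (simp add: nth_eq_iff_index_eq)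
  ultimately have "{c ! j, c ! k} \<in> E"
    using clique max jl kl by blast
  moreover have "k \<noteq> Suc j mod ?l" using sj i l by (auto simp: k_cases)
  moreover have "j \<noteq> Suc k mod ?l"
    using i l by (cases "Suc k = ?l") (auto simp: j_def k_cases split: if_splits)
  ultimately show "has_chord E c"
    using jl kl jk unfolding has_chord_def by blast
qed

section \<open>Shortcuts in walks and minimal separators\<close>

lemma successively_take: "successively P xs \<Longrightarrow> successively P (take n xs)"
  by (metis append_take_drop_id successively_append_iff)

lemma successively_drop: "successively P xs \<Longrightarrow> successively P (drop n xs)"
  by (metis append_take_drop_id successively_append_iff)

lemma walk_shortcut:
  assumes w: "successively P xs" and ij: "i < j" "j < length xs" and P: "P (xs ! i) (xs ! j)"
  shows "successively P (take (Suc i) xs @ drop j xs)"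
proof -
  have "last (take (Suc i) xs) = xs ! i" using ij by (simp add: take_Suc_conv_app_nth)
  moreover have "hd (drop j xs) = xs ! j" using ij by (simp add: hd_drop_conv_nth)
  ultimately show ?thesis
    using w P by (auto simp: successively_append_iff successively_take successively_drop)
qed

lemma walk_remove_loop:
  assumes w: "successively P xs" and ij: "i < j" "j < length xs" and eq: "xs ! i = xs ! j"
  shows "successively P (take i xs @ drop j xs)"
proof (cases i)
  case 0
  then show ?thesis using w by (simp add: successively_drop)
next
  case (Suc k)
  have "P (xs ! k) (xs ! Suc k)"
    using w ij Suc by (simp add: successively_conv_nth)
  then have "P (xs ! k) (xs ! j)" using eq Suc by simp
  then show ?thesis using walk_shortcut[OF w, of k j] ij Suc by simp
qed

text \<open>If \<open>c\<close> and \<open>c'\<close> are not adjacent, a shortest walk between them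
  with interior in \<open>B\<close> is an induced path. Closing it through \<open>a\<close>, which
  has no neighbour in \<open>B\<close>, would give a chordless cycle on at least four
  vertices.\<close>

lemma chordal_separator_clique:
  assumes ch: "chordal E" and no_loops: "\<And>x. {x} \<notin> E"
    and c: "{a, c} \<in> E" and c': "{a, c'} \<in> E" and neq: "c \<noteq> c'"
    and B: "\<And>b. b \<in> B \<Longrightarrow> b \<noteq> a \<and> {a, b} \<notin> E"
    and walk: "successively (\<lambda>x y. {x, y} \<in> E) (c # bs @ [c'])" and bs: "set bs \<subseteq> B" "bs \<noteq> []"
  shows "{c, c'} \<in> E"
proof (rule ccontr)
  assume nadj: "{c, c'} \<notin> E"
  let ?adj = "\<lambda>x y. {x, y} \<in> E"
  \<comment> \<open>At least three vertices are demanded so that closing the walk through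
    \<open>a\<close> gives a cycle longer than a triangle. Every shortening below has to preserve
    this bound.\<close>
  define Q where "Q p \<longleftrightarrow> successively ?adj p \<and> length p \<ge> 3 \<and> hd p = c \<and> last p = c' \<and>
     (\<forall>i. 0 < i \<and> Suc i < length p \<longrightarrow> p ! i \<in> B)" for p
  have "length bs \<ge> 1" using bs by (cases bs) auto
  then have "Q (c # bs @ [c'])"
    using walk bs by (auto simp: Q_def nth_Cons nth_append split: nat.splits)
  then obtain p where p: "Q p" and minimal: "\<And>p'. Q p' \<Longrightarrow> length p \<le> length p'"
    using ex_has_least_nat[of Q _ length] by metis
  let ?l = "length p"
  have succ: "successively ?adj p" and l3: "?l \<ge> 3" and hd: "p ! 0 = c" and last: "p ! (?l - 1) = c'"
    and inner: "\<And>i. 0 < i \<Longrightarrow> Suc i < ?l \<Longrightarrow> p ! i \<in> B"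
    using p unfolding Q_def by (auto simp: hd_conv_nth last_conv_nth simp flip: length_greater_0_conv)
  have c_notin: "c \<notin> B" "c' \<notin> B" using c c' B by auto
  have short: False
    if q: "successively ?adj (take i p @ drop j p)" and ij: "i < j" "j < ?l" and pos: "0 < i"
      and ne: "i + (?l - j) \<ge> 3" for i j
  proof -
    let ?q = "take i p @ drop j p"
    have len: "length ?q = i + (?l - j)" using ij by simp
    have "?q ! k \<in> B" if "0 < k" "Suc k < length ?q" for k
    proof (cases "k < i")
      case True
      then show ?thesis using inner[of k] that ij by (simp add: nth_append)
    next
      case False
      then have "?q ! k = p ! (j + (k - i))" using ij by (simp add: nth_append min_def)
      moreover have "Suc (j + (k - i)) < ?l" using that False ij len by simp
      ultimately show ?thesis using inner[of "j + (k - i)"] ij by simp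
    qed
    moreover have "hd ?q = c" using hd ij pos l3 by (cases p; cases i) auto
    moreover have "last ?q = c'"
      using p ij by (simp add: Q_def last_append)
    ultimately have "Q ?q" using q len ne unfolding Q_def by simp
    then show False using minimal[of ?q] len ij by simp
  qed
  have chordless: "j = Suc i" if ij: "i < j" "j < ?l" and adj: "?adj (p ! i) (p ! j)" for i j
  proof (rule ccontr)
    assume ne: "j \<noteq> Suc i"
    have "\<not> (i = 0 \<and> j = ?l - 1)" using adj nadj hd last by auto
    then have "Suc i + (?l - j) \<ge> 3" using ij by linarith
    then show False using short[OF walk_shortcut[OF succ ij adj]] ij ne by simp
  qed
  have dist: "distinct p"
  proof -
    have False if ij: "i < j" "j < ?l" and eq: "p ! i = p ! j" for i j
    proof (cases "i = 0")
      case True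
      have "p ! j \<notin> B" using eq True hd c_notin by simp
      then have "j = ?l - 1" using inner[of j] ij by (cases "Suc j < ?l") auto
      then show False using eq True hd last neq by simp
    next
      case False
      show False
      proof (cases "i + (?l - j) \<ge> 3")
        case True
        then show False using short[OF walk_remove_loop[OF succ ij eq] ij] False by simp
      next
        \<comment> \<open>Only a loop from position 1 to the last position is too long to be cut
          out, and it would put \<open>c'\<close> into \<open>B\<close>.\<close>
        case lt: False
        then have "i = 1" "j = ?l - 1" using ij False by auto
        then have "p ! i \<notin> B" using eq last c_notin by simp
        then show False using inner[of i] \<open>i = 1\<close> l3 by simp
      qed
    qed
    then show ?thesis
      unfolding distinct_conv_nth by (metis nat_neq_iff)
  qed
  have a_notin: "a \<notin> set p"
  proof
    assume "a \<in> set p"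
    then obtain i where i: "i < ?l" "p ! i = a" by (auto simp: in_set_conv_nth)
    have "a \<noteq> c" "a \<noteq> c'" using c c' no_loops by auto
    then have "0 < i" "Suc i < ?l" using i hd last by (cases i; auto; metis Suc_lessI diff_Suc_1)+
    then show False using inner[of i] i B by auto
  qed
  let ?c = "p @ [a]"
  have "is_cycle E ?c"
    unfolding is_cycle_def
  proof (intro conjI allI impI)
    show "3 \<le> length ?c" "distinct ?c" using l3 dist a_notin by auto
    fix i assume "i < length ?c"
    then consider "Suc i < ?l" | "i = ?l - 1" "Suc i = ?l" | "i = ?l" using l3 by fastforce
    then show "{?c ! i, ?c ! (Suc i mod length ?c)} \<in> E"
    proof cases
      case 1
      then show ?thesis using succ by (simp add: nth_append successively_conv_nth)
    next
      case 2
      then show ?thesis using last c' l3 by (simp add: nth_append insert_commute)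
    next
      case 3
      moreover have "p \<noteq> []" using l3 by auto
      ultimately show ?thesis using hd c by (simp add: nth_append)
    qed
  qed
  then have "has_chord E ?c" using ch l3 by (auto simp: chordal_def)
  then obtain i j where ij: "i < Suc ?l" "j < Suc ?l" "i \<noteq> j" "j \<noteq> Suc i mod Suc ?l"
    "i \<noteq> Suc j mod Suc ?l" "{?c ! i, ?c ! j} \<in> E"
    by (auto simp: has_chord_def)
  \<comment> \<open>Position \<open>?l\<close> of the cycle is \<open>a\<close>: a chord there would
    join \<open>a\<close> to an interior vertex, which lies in \<open>B\<close>. Any other chord
    would be a chord of the path.\<close>
  have main: False if ij: "i < j" "j < Suc ?l" "j \<noteq> Suc i mod Suc ?l"
    "i \<noteq> Suc j mod Suc ?l" "{?c ! i, ?c ! j} \<in> E" for i j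
  proof (cases "j = ?l")
    case True
    then have "0 < i" "Suc i < ?l" using ij by (cases i; auto)+
    then have "p ! i \<in> B" by (rule inner)
    moreover have "{a, p ! i} \<in> E" using ij True by (simp add: nth_append insert_commute)
    ultimately show False using B by blast
  next
    case False
    then have "j = Suc i" using chordless[of i j] ij by (simp add: nth_append)
    then show False using ij False by simp
  qed
  consider "i < j" | "j < i" using ij by linarith
  then show False
  proof cases
    case 1
    then show False using main[of i j] ij by simp
  next
    case 2
    then show False using main[of j i] ij by (simp add: insert_commute)
  qed
qed

section \<open>Simplicial vertices and perfect elimination\<close>

definition simplicial :: "'a set set \<Rightarrow> 'a set \<Rightarrow> 'a \<Rightarrow> bool" where
  "simplicial E V v \<longleftrightarrow> v \<in> V \<and>
     (\<forall>x\<in>V. \<forall>y\<in>V. {v, x} \<in> E \<longrightarrow> {v, y} \<in> E \<longrightarrow> x \<noteq> y \<longrightarrow> {x, y} \<in> E)"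

lemma rtranclp_imp_walk:
  assumes "R\<^sup>*\<^sup>* x y"
  obtains p where "p \<noteq> []" "hd p = x" "last p = y" "successively R p" "set p \<subseteq> {z. R\<^sup>*\<^sup>* x z}"
  using assms
proof (induction arbitrary: thesis rule: rtranclp_induct)
  case base
  show ?case by (rule base[of "[x]"]) auto
next
  case (step y z)
  obtain p where p: "p \<noteq> []" "hd p = x" "last p = y" "successively R p" "set p \<subseteq> {z. R\<^sup>*\<^sup>* x z}"
    using step.IH by blast
  show ?case
    by (rule step.prems[of "p @ [z]"])
      (use p step.hyps in \<open>auto simp: successively_append_iff intro: rtranclp.rtrancl_into_rtrancl\<close>)
qed

text \<open>
  Dirac's theorem. A connected component \<open>B\<close> of the graph without the closed neighbourhood of \<open>a\<close> has
  a clique \<open>C\<close> as its boundary; the induction hypothesis is applied to \<open>B \<union> C\<close> and a non-universal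
  vertex of \<open>C\<close>, or to \<open>B\<close> if there is none.
\<close>

lemma chordal_simplicial:
  assumes ch: "chordal E" and no_loops: "\<And>x. {x} \<notin> E" and "finite V"
  shows "(V \<noteq> {} \<longrightarrow> (\<exists>v. simplicial E V v)) \<and>
    (\<forall>a\<in>V. (\<exists>b\<in>V. b \<noteq> a \<and> {a, b} \<notin> E) \<longrightarrow> (\<exists>v. simplicial E V v \<and> v \<noteq> a \<and> {a, v} \<notin> E))"
  using \<open>finite V\<close>
proof (induction V rule: finite_psubset_induct)
  case (psubset V)
  have outside: "\<exists>v. simplicial E V v \<and> v \<noteq> a \<and> {a, v} \<notin> E"
    if a: "a \<in> V" and b0: "b0 \<in> V" "b0 \<noteq> a" "{a, b0} \<notin> E" for a b0
  proof -
    define A where "A = {x \<in> V. x \<noteq> a \<and> {a, x} \<notin> E}"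
    define R where "R x y \<longleftrightarrow> x \<in> A \<and> y \<in> A \<and> {x, y} \<in> E" for x y
    define B where "B = {x. R\<^sup>*\<^sup>* b0 x}"
    define C where "C = {x \<in> V - B. \<exists>b\<in>B. {b, x} \<in> E}"
    have "b0 \<in> A" using b0 by (simp add: A_def)
    have BA: "B \<subseteq> A"
    proof
      fix x assume "x \<in> B"
      then have "R\<^sup>*\<^sup>* b0 x" by (simp add: B_def)
      then show "x \<in> A" using \<open>b0 \<in> A\<close> by cases (auto simp: R_def)
    qed
    have "b0 \<in> B" by (simp add: B_def)
    have sym: "symp R" by (auto simp: symp_def R_def insert_commute)
    have conn: "R\<^sup>*\<^sup>* x y" if "x \<in> B" "y \<in> B" for x y
    proof -
      have "R\<^sup>*\<^sup>* x b0"
        using that(1) sym unfolding B_def by (metis mem_Collect_eq symp_rtranclp sympD)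
      then show ?thesis using that(2) by (auto simp: B_def)
    qed
    have B_closed: "y \<in> B" if "x \<in> B" "y \<in> A" "{x, y} \<in> E" for x y
    proof -
      have "R x y" using that BA by (auto simp: R_def)
      then show ?thesis using that(1) by (auto simp: B_def)
    qed
    have C_nbr: "{a, x} \<in> E" if "x \<in> C" for x
    proof -
      obtain b where b: "b \<in> B" "{b, x} \<in> E" "x \<in> V" "x \<notin> B" using \<open>x \<in> C\<close> by (auto simp: C_def)
      have "x \<noteq> a" using b BA by (auto simp: A_def insert_commute)
      then show ?thesis using B_closed[of b x] b by (auto simp: A_def)
    qed
    have C_clique: "{c, c'} \<in> E" if cc: "c \<in> C" "c' \<in> C" "c \<noteq> c'" for c c'
    proof -
      obtain b b' where b: "b \<in> B" "{b, c} \<in> E" "b' \<in> B" "{b', c'} \<in> E"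
        using cc by (auto simp: C_def)
      obtain p where p: "p \<noteq> []" "hd p = b" "last p = b'" "successively R p" "set p \<subseteq> {z. R\<^sup>*\<^sup>* b z}"
        using rtranclp_imp_walk[OF conn[OF b(1,3)]] by blast
      have "set p \<subseteq> B" using p(5) b(1) by (auto simp: B_def)
      have succ: "successively (\<lambda>x y. {x, y} \<in> E) p"
        using p(4) by (rule successively_mono) (auto simp: R_def)
      show ?thesis
      proof (rule chordal_separator_clique[OF ch no_loops C_nbr[OF cc(1)] C_nbr[OF cc(2)] cc(3)])
        show "b \<noteq> a \<and> {a, b} \<notin> E" if "b \<in> B" for b using that BA by (auto simp: A_def)
        show "successively (\<lambda>x y. {x, y} \<in> E) (c # p @ [c'])"
          using succ p b by (auto simp: successively_append_iff successively_Cons insert_commute)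
      qed fact+
    qed
    have nbr: "x \<in> B \<union> C" if "v \<in> B" "x \<in> V" "{v, x} \<in> E" for v x
      using that by (auto simp: C_def)
    have sub: "B \<union> C \<subset> V"
    proof -
      have "a \<notin> B" using BA by (auto simp: A_def)
      moreover have "a \<notin> C" using C_nbr[of a] no_loops[of a] by auto
      ultimately show ?thesis using a BA by (auto simp: A_def C_def)
    qed
    \<comment> \<open>In the first case the simplicial vertex is not adjacent to \<open>c\<close>,
      hence lies in \<open>B\<close>, because \<open>C\<close> is a clique. In the second case a
      simplicial vertex of \<open>B\<close> stays simplicial when the universal vertices of
      \<open>C\<close> are added.\<close>
    obtain v where v: "v \<in> B" "simplicial E (B \<union> C) v"
    proof (cases "\<exists>c\<in>C. \<exists>d\<in>B \<union> C. d \<noteq> c \<and> {c, d} \<notin> E")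
      case True
      then obtain c where c: "c \<in> C" "\<exists>d\<in>B \<union> C. d \<noteq> c \<and> {c, d} \<notin> E" by blast
      then obtain v where "simplicial E (B \<union> C) v" "v \<noteq> c" "{c, v} \<notin> E"
        using psubset.IH[OF sub] by blast
      then show ?thesis using that C_clique[of c v] c by (auto simp: simplicial_def)
    next
      case False
      have "B \<subset> V" using sub by blast
      then have "\<exists>v. simplicial E B v" using psubset.IH[of B] \<open>b0 \<in> B\<close> by auto
      then obtain v where v: "simplicial E B v" by blast
      have "{x, y} \<in> E" if "x \<in> B \<union> C" "y \<in> B \<union> C" "{v, x} \<in> E" "{v, y} \<in> E" "x \<noteq> y" for x y
      proof (cases "x \<in> B \<and> y \<in> B")
        case True
        then show ?thesis using v that by (auto simp: simplicial_def)
      next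
        case F: False
        then show ?thesis using False that by (metis UnE insert_commute)
      qed
      then have "simplicial E (B \<union> C) v" using v by (auto simp: simplicial_def)
      then show ?thesis using that v by (auto simp: simplicial_def)
    qed
    \<comment> \<open>No vertex of \<open>B\<close> has a neighbour in \<open>V\<close> outside
      \<open>B \<union> C\<close>.\<close>
    have "simplicial E V v"
      unfolding simplicial_def
    proof (intro conjI ballI impI)
      show "v \<in> V" using v(1) sub by blast
      show "{x, y} \<in> E" if "x \<in> V" "y \<in> V" "{v, x} \<in> E" "{v, y} \<in> E" "x \<noteq> y" for x y
        using that v nbr[of v x] nbr[of v y] by (simp add: simplicial_def)
    qed
    then show ?thesis using v(1) BA by (auto simp: A_def)
  qed
  have nonempty: "\<exists>v. simplicial E V v" if "V \<noteq> {}"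
  proof (cases "\<exists>a\<in>V. \<exists>b\<in>V. b \<noteq> a \<and> {a, b} \<notin> E")
    case True
    then show ?thesis using outside by blast
  next
    case False
    then have "{x, y} \<in> E" if "x \<in> V" "y \<in> V" "x \<noteq> y" for x y using that by metis
    then show ?thesis using that unfolding simplicial_def by auto
  qed
  show ?case
  proof (intro conjI impI ballI)
    show "\<exists>v. simplicial E V v" if "V \<noteq> {}" using nonempty that .
    show "\<exists>v. simplicial E V v \<and> v \<noteq> a \<and> {a, v} \<notin> E"
      if "a \<in> V" "\<exists>b\<in>V. b \<noteq> a \<and> {a, b} \<notin> E" for a
      using that(2) by (elim bexE conjE) (rule outside[OF that(1)])
  qed
qed

text \<open>A simplicial vertex is removed and ranked above all the others, so its earlier
  neighbours are all its neighbours in \<open>V\<close>. The result is a reversed elimination order: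
  the earlier neighbours of each vertex form a clique.\<close>

lemma chordal_elimination_order:
  assumes ch: "chordal E" and no_loops: "\<And>x. {x} \<notin> E" and "finite V"
  shows "\<exists>f :: 'a \<Rightarrow> nat. inj_on f V \<and> (\<forall>v\<in>V. \<forall>x\<in>V. \<forall>y\<in>V.
    {v, x} \<in> E \<longrightarrow> {v, y} \<in> E \<longrightarrow> f x < f v \<longrightarrow> f y < f v \<longrightarrow> x \<noteq> y \<longrightarrow> {x, y} \<in> E)"
  using \<open>finite V\<close>
proof (induction V rule: finite_psubset_induct)
  case (psubset V)
  show ?case
  proof (cases "V = {}")
    case False
    then have "\<exists>s. simplicial E V s"
      using chordal_simplicial[OF ch no_loops psubset.hyps] by simp
    then obtain s where s: "simplicial E V s" by blast
    then have sV: "s \<in> V" by (simp add: simplicial_def)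
    then have "V - {s} \<subset> V" by blast
    from psubset.IH[OF this] obtain f :: "'a \<Rightarrow> nat" where f: "inj_on f (V - {s})"
      "\<And>v x y. v \<in> V - {s} \<Longrightarrow> x \<in> V - {s} \<Longrightarrow> y \<in> V - {s} \<Longrightarrow> {v, x} \<in> E \<Longrightarrow> {v, y} \<in> E \<Longrightarrow>
         f x < f v \<Longrightarrow> f y < f v \<Longrightarrow> x \<noteq> y \<Longrightarrow> {x, y} \<in> E"
      by (elim exE conjE) metis
    define g where "g = f(s := Suc (Max (f ` V)))"
    have big: "f x < g s" if "x \<in> V" for x
      using that psubset.hyps by (simp add: g_def le_imp_less_Suc)
    have g_eq: "g x = f x" if "x \<noteq> s" for x using that by (simp add: g_def)
    have "inj_on g V"
      using f(1) big g_eq unfolding inj_on_def by (metis Diff_iff empty_iff insert_iff nat_neq_iff)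
    moreover have "{x, y} \<in> E" if *: "v \<in> V" "x \<in> V" "y \<in> V" "{v, x} \<in> E" "{v, y} \<in> E"
      "g x < g v" "g y < g v" "x \<noteq> y" for v x y
    proof (cases "v = s")
      case True
      then show ?thesis using s * by (auto simp: simplicial_def)
    next
      case False
      have "x \<noteq> s" "y \<noteq> s" using big[of v] g_eq[OF False] * by auto
      then show ?thesis using f(2)[of v x y] * False g_eq by simp
    qed
    ultimately show ?thesis by blast
  qed auto
qed

section \<open>Compression of subtree models\<close>

text \<open>
  A chordal graph as an intersection graph of subtrees of a rooted forest \<open>\<preceq>\<close> whose nodes are the
  vertices themselves: \<open>t y x\<close> says that the subtree of \<open>y\<close>, whose root is \<open>y\<close>, contains the node \<open>x\<close>.
\<close>

locale subtree_model =
  fixes V :: "'a set" and le :: "'a \<Rightarrow> 'a \<Rightarrow> bool" (infix "\<preceq>" 50)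
    and t :: "'a \<Rightarrow> 'a \<Rightarrow> bool" and f :: "'a \<Rightarrow> nat" and N :: nat
  assumes finite_V: "finite V" and inj_f: "inj_on f V"
    and le_refl: "x \<preceq> x"
    and le_trans: "x \<preceq> y \<Longrightarrow> y \<preceq> z \<Longrightarrow> x \<preceq> z"
    and le_rank: "x \<preceq> y \<Longrightarrow> x \<noteq> y \<Longrightarrow> f x < f y"
    and le_closed: "x \<preceq> y \<Longrightarrow> y \<in> V \<Longrightarrow> x \<in> V"
    and le_chain: "x \<preceq> z \<Longrightarrow> y \<preceq> z \<Longrightarrow> x \<preceq> y \<or> y \<preceq> x"
    and t_refl: "t x x"
    and t_le: "t y x \<Longrightarrow> y \<preceq> x"
    and t_convex: "t y x \<Longrightarrow> y \<preceq> z \<Longrightarrow> z \<preceq> x \<Longrightarrow> t y z"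
begin

definition below :: "'a \<Rightarrow> 'a set" where "below x = {y \<in> V. x \<preceq> y}"

definition missed :: "'a \<Rightarrow> 'a set" where "missed x = {y \<in> V. y \<preceq> x \<and> \<not> t y x}"

text \<open>With roots at the top, \<open>below\<close> shrinks and \<open>missed\<close> grows
  along every downward path. Measuring both in units of \<open>card V / N\<close> cuts such a path
  into intervals of constant level, in which neither count changes by a full unit.\<close>

definition level :: "'a \<Rightarrow> nat \<times> nat" where
  "level x = (card (below x) * N div card V, card (missed x) * N div card V)"

text \<open>The threshold is \<open>card V / N\<close> descendants. All edges from a vertex that is
  not heavy to its descendants may be given up.\<close>

definition heavy :: "'a set" where "heavy = {x \<in> V. card V < card (below x) * N}"

text \<open>
  Along every root-to-leaf path of heavy nodes only the last node of each level is kept. At a node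
  with two incomparable heavy descendants the first component of the level jumps, which makes the
  skeleton closed under meets.
\<close>

definition skel :: "'a set" where
  "skel = {x \<in> heavy. \<forall>c\<in>heavy. x \<preceq> c \<longrightarrow> level c = level x \<longrightarrow> c = x}"

section \<open>Size of the skeleton and closure under meets\<close>

lemma le_rank': "x \<preceq> y \<Longrightarrow> f x \<le> f y"
  using le_rank by (cases "x = y") (auto intro: less_imp_le)

lemma le_antisym: "x \<preceq> y \<Longrightarrow> f y \<le> f x \<Longrightarrow> x = y"
  using le_rank by force

lemma skel_heavy: "x \<in> skel \<Longrightarrow> x \<in> heavy" by (simp add: skel_def)

lemma skel_V: "x \<in> skel \<Longrightarrow> x \<in> V" by (simp add: skel_def heavy_def)

lemma finite_skel: "finite skel"
  using finite_V skel_V by (auto intro: finite_subset[of _ V])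

lemma finite_below [simp]: "finite (below x)" and finite_missed [simp]: "finite (missed x)"
  using finite_V by (auto simp: below_def missed_def)

lemma below_mono: "x \<preceq> y \<Longrightarrow> below y \<subseteq> below x"
  by (auto simp: below_def intro: le_trans)

lemma missed_mono: "x \<preceq> y \<Longrightarrow> missed x \<subseteq> missed y"
  by (auto simp: missed_def intro: le_trans t_convex)

lemma heavy_up: "x \<preceq> y \<Longrightarrow> y \<in> heavy \<Longrightarrow> x \<in> heavy"
proof -
  assume xy: "x \<preceq> y" and y: "y \<in> heavy"
  have "card (below y) * N \<le> card (below x) * N" using below_mono[OF xy] by (simp add: card_mono)
  with y have "card V < card (below x) * N" unfolding heavy_def by (metis (lifting) mem_Collect_eq order_less_le_trans)
  then show ?thesis using y le_closed[OF xy] by (simp add: heavy_def)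
qed

lemma below_disjoint:
  assumes "\<not> x \<preceq> y" "\<not> y \<preceq> x"
  shows "below x \<inter> below y = {}"
  using assms le_chain by (auto simp: below_def)

lemma card_V_pos: "x \<in> V \<Longrightarrow> card V > 0"
  using finite_V by (auto simp: card_gt_0_iff)

lemma div_eq_imp_diff_less:
  fixes a b n :: nat
  assumes "a div n = b div n" "n > 0" "b \<le> a"
  shows "a - b < n"
proof -
  have "a = a div n * n + a mod n" "b = b div n * n + b mod n" by simp_all
  then have "a - b = a mod n - b mod n" using assms(1) by (metis diff_cancel2 add.commute)
  then show ?thesis using assms(2) by (metis less_imp_diff_less mod_less_divisor)
qed

text \<open>The heavy node of largest rank among those below \<open>x\<close> with the level of
  \<open>x\<close> has no heavy proper descendant of that level.\<close>

lemma skel_same_level: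
  assumes "x \<in> heavy"
  obtains z where "z \<in> skel" "x \<preceq> z" "level z = level x"
proof -
  define A where "A = {z \<in> heavy. x \<preceq> z \<and> level z = level x}"
  have "finite A" using finite_V by (auto simp: A_def heavy_def)
  moreover have "x \<in> A" using assms le_refl by (simp add: A_def)
  ultimately obtain z where z: "z \<in> A" and max: "\<And>y. y \<in> A \<Longrightarrow> f y \<le> f z"
    using Max_in[of "f ` A"] Max_ge[of "f ` A"] by (metis (no_types, lifting) empty_iff finite_imageI image_iff imageI)
  have "z \<in> skel"
    unfolding skel_def
  proof (intro CollectI conjI ballI impI)
    show "z \<in> heavy" using z by (simp add: A_def)
    fix c assume c: "c \<in> heavy" "z \<preceq> c" "level c = level z"
    then have "c \<in> A" using z by (auto simp: A_def intro: le_trans)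
    then show "c = z" using max le_antisym c by force
  qed
  then show ?thesis using that z by (auto simp: A_def)
qed

text \<open>For incomparable \<open>s\<close> and \<open>s'\<close> the deepest common ancestor
  \<open>b\<close> works. If \<open>c\<close> is a heavy proper descendant of \<open>b\<close>, then
  \<open>below c\<close> is disjoint from \<open>below s\<close> or from \<open>below s'\<close>,
  each of which has more than \<open>card V / N\<close> elements; so the first component of the
  level differs at \<open>b\<close> and \<open>c\<close>.\<close>

lemma skel_meet:
  assumes s: "s \<in> skel" "s' \<in> skel" and x: "x \<preceq> s" "x \<preceq> s'"
  obtains b where "b \<in> skel" "x \<preceq> b" "b \<preceq> s" "b \<preceq> s'"
proof (cases "s \<preceq> s' \<or> s' \<preceq> s")
  case True
  then show ?thesis using that s x le_refl by blast
next
  case False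
  define A where "A = {b. x \<preceq> b \<and> b \<preceq> s \<and> b \<preceq> s'}"
  have "A \<subseteq> V" using s skel_V le_closed by (auto simp: A_def)
  then have "finite A" using finite_V finite_subset by blast
  moreover have "x \<in> A" using x le_refl by (simp add: A_def)
  ultimately obtain b where b: "b \<in> A" and max: "\<And>y. y \<in> A \<Longrightarrow> f y \<le> f b"
    using Max_in[of "f ` A"] Max_ge[of "f ` A"] by (metis (no_types, lifting) empty_iff finite_imageI image_iff imageI)
  have bs: "b \<preceq> s" "b \<preceq> s'" "x \<preceq> b" using b by (auto simp: A_def)
  have jump: "level c \<noteq> level b"
    if c: "c \<in> heavy" "b \<preceq> c" and r: "r \<in> skel" "b \<preceq> r" and disj: "below c \<inter> below r = {}" for c r
  proof
    assume eq: "level c = level b"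
    have "below c \<union> below r \<subseteq> below b" using below_mono c r by blast
    then have "card (below c) + card (below r) \<le> card (below b)"
      using disj by (metis card_Un_disjoint card_mono finite_below)
    then have "card (below c) * N + card (below r) * N \<le> card (below b) * N"
      by (metis add_mult_distrib mult_le_mono1)
    moreover have "card (below b) * N - card (below c) * N < card V"
    proof (rule div_eq_imp_diff_less)
      show "card (below b) * N div card V = card (below c) * N div card V"
        using eq by (simp add: level_def)
      show "card V > 0" using card_V_pos skel_V s by blast
      show "card (below c) * N \<le> card (below b) * N"
        using below_mono[OF c(2)] by (simp add: card_mono)
    qed
    moreover have "card V < card (below r) * N" using skel_heavy[OF r(1)] by (simp add: heavy_def)
    ultimately show False by linarith
  qed
  have "b \<in> skel"
    unfolding skel_def
  proof (intro CollectI conjI ballI impI)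
    show "b \<in> heavy" using heavy_up bs s skel_heavy by blast
    fix c assume c: "c \<in> heavy" "b \<preceq> c" "level c = level b"
    show "c = b"
    proof (rule ccontr)
      assume "c \<noteq> b"
      then have "c \<notin> A" using max le_rank[OF c(2)] by force
      then have nc: "\<not> c \<preceq> s \<or> \<not> c \<preceq> s'" using bs c le_trans by (auto simp: A_def)
      have "\<exists>r\<in>{s, s'}. below c \<inter> below r = {}"
      proof (cases "s \<preceq> c \<or> c \<preceq> s")
        case True
        then show ?thesis
          using nc False below_disjoint[of s s'] below_mono[of s c] below_disjoint[of c s'] le_trans[of s c s'] le_trans[of s' c s] le_chain[of s c s']
          by (metis (no_types, opaque_lifting) disjoint_iff insertI1 insert_commute subset_iff)
      next
        case False
        then show ?thesis using below_disjoint by blast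
      qed
      then show False using jump[OF c(1,2)] c(3) s bs by blast
    qed
  qed
  then show ?thesis using that bs by blast
qed

lemma card_missed_le: "card (missed x) \<le> card V" and card_below_le: "card (below x) \<le> card V"
  using finite_V by (auto simp: missed_def below_def intro!: card_mono)

text \<open>The set \<open>L\<close> of deepest heavy nodes has at most \<open>N\<close> elements,
  as their disjoint sets \<open>below\<close> each exceed \<open>card V / N\<close>. A skeleton node
  is determined by its level and one element of \<open>L\<close> beneath it, and there are at most
  \<open>(N + 1)\<^sup>2\<close> levels.\<close>

lemma card_skel: "card skel \<le> N * (N + 1)\<^sup>2"
proof (cases "V = {}")
  case True
  then show ?thesis using skel_V by (metis bot_nat_0.extremum card.empty equals0I empty_iff)
next
  case False
  then have Vpos: "card V > 0" using finite_V by (simp add: card_gt_0_iff)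
  define L where "L = {x \<in> heavy. \<forall>c\<in>heavy. x \<preceq> c \<longrightarrow> c = x}"
  have LV: "L \<subseteq> V" by (auto simp: L_def heavy_def)
  then have finL: "finite L" using finite_V finite_subset by blast
  have "\<exists>l\<in>L. x \<preceq> l" if "x \<in> heavy" for x
  proof -
    define A where "A = {z \<in> heavy. x \<preceq> z}"
    have "finite A" using finite_V by (auto simp: A_def heavy_def)
    moreover have "x \<in> A" using that le_refl by (simp add: A_def)
    ultimately obtain z where z: "z \<in> A" and max: "\<And>y. y \<in> A \<Longrightarrow> f y \<le> f z"
      using Max_in[of "f ` A"] Max_ge[of "f ` A"] by (metis (no_types, lifting) empty_iff finite_imageI image_iff imageI)
    have "z \<in> L"
      unfolding L_def
    proof (intro CollectI conjI ballI impI)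
      show "z \<in> heavy" using z by (simp add: A_def)
      fix c assume c: "c \<in> heavy" "z \<preceq> c"
      then have "c \<in> A" using z by (auto simp: A_def intro: le_trans)
      then show "c = z" using max le_antisym c by force
    qed
    then show ?thesis using z by (auto simp: A_def)
  qed
  then obtain leaf where leaf: "\<And>x. x \<in> heavy \<Longrightarrow> leaf x \<in> L \<and> x \<preceq> leaf x" by metis
  have cardL: "card L \<le> N"
  proof -
    have "disjoint_family_on below L"
      unfolding disjoint_family_on_def
    proof (intro ballI impI)
      fix x y assume "x \<in> L" "y \<in> L" "x \<noteq> y"
      then show "below x \<inter> below y = {}" by (intro below_disjoint) (auto simp: L_def)
    qed
    then have "(\<Sum>x\<in>L. card (below x)) = card (\<Union>x\<in>L. below x)"
      using finL by (subst card_UN_disjoint) (auto simp: disjoint_family_on_def)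
    also have "\<dots> \<le> card V" using finite_V by (intro card_mono) (auto simp: below_def)
    finally have sum_le: "(\<Sum>x\<in>L. card (below x)) \<le> card V" .
    have "card L * card V = (\<Sum>x\<in>L. card V)" by simp
    also have "\<dots> \<le> (\<Sum>x\<in>L. card (below x) * N)"
      by (rule sum_mono) (auto simp: L_def heavy_def)
    also have "\<dots> = (\<Sum>x\<in>L. card (below x)) * N" by (rule sum_distrib_right[symmetric])
    also have "\<dots> \<le> card V * N" using sum_le by simp
    finally have "card V * card L \<le> card V * N" by (simp only: mult.commute)
    then show ?thesis using Vpos by simp
  qed
  have "inj_on (\<lambda>x. (leaf x, level x)) skel"
  proof (rule inj_onI)
    fix x y assume x: "x \<in> skel" and y: "y \<in> skel" and eq: "(leaf x, level x) = (leaf y, level y)"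
    have "x \<preceq> leaf x" "y \<preceq> leaf x" using leaf[OF skel_heavy[OF x]] leaf[OF skel_heavy[OF y]] eq by auto
    then show "x = y" using le_chain[of x "leaf x" y] x y eq unfolding skel_def by auto
  qed
  moreover have "(\<lambda>x. (leaf x, level x)) ` skel \<subseteq> L \<times> ({..N} \<times> {..N})"
  proof -
    have "k * N div card V \<le> N" if "k \<le> card V" for k
      using that Vpos by (metis div_le_mono div_mult_self1_is_m mult_le_mono1)
    then show ?thesis using leaf skel_heavy card_missed_le card_below_le by (auto simp: level_def)
  qed
  ultimately have "card skel \<le> card (L \<times> ({..N} \<times> {..N}))"
    using finL by (intro card_inj_on_le) auto
  also have "\<dots> = card L * (N + 1)\<^sup>2" by (simp add: card_cartesian_product power2_eq_square)
  also have "\<dots> \<le> N * (N + 1)\<^sup>2" using cardL by simp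
  finally show ?thesis .
qed

section \<open>Traces of subtrees on the skeleton\<close>

definition footprint :: "'a \<Rightarrow> 'a set" where "footprint x = {s \<in> skel. t x s}"

text \<open>Smallest rank means topmost. The value is meaningful only for a nonempty trace.\<close>

definition apex :: "'a \<Rightarrow> 'a" where "apex x = (ARG_MIN f s. s \<in> footprint x)"

lemma apex:
  assumes "footprint x \<noteq> {}"
  shows "apex x \<in> footprint x" and "s \<in> footprint x \<Longrightarrow> f (apex x) \<le> f s"
  using assms arg_min_natI[of "\<lambda>s. s \<in> footprint x" _ f] arg_min_nat_le[of "\<lambda>s. s \<in> footprint x" _ f]
  by (auto simp: apex_def)

lemma finite_footprint: "finite (footprint x)" using finite_skel by (simp add: footprint_def)

text \<open>The skeleton has a common ancestor \<open>b\<close> of \<open>apex x\<close> and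
  \<open>s\<close> that is still below \<open>x\<close>. Convexity puts \<open>b\<close> into the
  trace, and minimality of the rank makes it the apex.\<close>

lemma apex_le:
  assumes s: "s \<in> skel" and x: "x \<preceq> s" and ne: "footprint x \<noteq> {}"
  shows "apex x \<preceq> s"
proof -
  have tp: "apex x \<in> skel" "t x (apex x)" using apex[OF ne] by (auto simp: footprint_def)
  obtain b where b: "b \<in> skel" "x \<preceq> b" "b \<preceq> apex x" "b \<preceq> s"
    using skel_meet[OF tp(1) s t_le[OF tp(2)] x] by blast
  then have "b \<in> footprint x" using t_convex tp by (auto simp: footprint_def)
  then have "b = apex x" using apex(2)[OF ne] b le_antisym by blast
  then show ?thesis using b by simp
qed

text \<open>If \<open>y\<close> is not heavy, it has few descendants altogether. Otherwise the
  skeleton node \<open>z\<close> with the level of \<open>y\<close> intercepts every descendant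
  except those in \<open>below y - below z\<close>, and equal levels make this difference smaller
  than one unit.\<close>

lemma lost_descendants:
  assumes "y \<in> V"
  shows "N * card {x \<in> V. y \<preceq> x \<and> \<not> (\<exists>z\<in>skel. y \<preceq> z \<and> z \<preceq> x)} \<le> card V" (is "N * card ?A \<le> _")
proof (cases "y \<in> heavy")
  case False
  have "card ?A \<le> card (below y)"
    by (rule card_mono[OF finite_below]) (auto simp only: below_def)
  then have "N * card ?A \<le> N * card (below y)" by (rule mult_le_mono2)
  also have "\<dots> \<le> card V" using False assms by (simp add: heavy_def mult.commute)
  finally show ?thesis .
next
  case True
  obtain z where z: "z \<in> skel" "y \<preceq> z" "level z = level y" using skel_same_level[OF True] by blast
  have "?A \<subseteq> below y - below z" using z by (auto simp: below_def)
  then have "card ?A \<le> card (below y - below z)" by (rule card_mono[rotated]) simp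
  also have "\<dots> = card (below y) - card (below z)"
    by (rule card_Diff_subset[OF finite_below below_mono[OF z(2)]])
  finally have "card ?A \<le> card (below y) - card (below z)" .
  then have "card ?A * N \<le> (card (below y) - card (below z)) * N" by (rule mult_le_mono1)
  also have "\<dots> = card (below y) * N - card (below z) * N" by (rule diff_mult_distrib)
  also have "\<dots> < card V"
    by (rule div_eq_imp_diff_less)
      (use z card_V_pos[OF assms] below_mono[OF z(2)] in \<open>auto simp: level_def card_mono\<close>)
  finally show ?thesis by (simp add: mult.commute)
qed

text \<open>Let \<open>z\<close> be the skeleton node with the level of \<open>x\<close>. As
  \<open>apex x\<close> lies between \<open>x\<close> and \<open>z\<close>, convexity shows that a
  subtree which contains \<open>x\<close> but not \<open>apex x\<close> misses \<open>z\<close> as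
  well. So its root is in \<open>missed z - missed x\<close>, which is smaller than one
  unit.\<close>

lemma lost_ancestors:
  assumes ne: "footprint x \<noteq> {}"
  shows "N * card {y \<in> V. t y x \<and> \<not> t y (apex x)} \<le> card V" (is "N * card ?A \<le> _")
proof -
  have tp: "apex x \<in> skel" "t x (apex x)" using apex[OF ne] by (auto simp: footprint_def)
  then have "x \<in> heavy" using heavy_up skel_heavy t_le by blast
  then obtain z where z: "z \<in> skel" "x \<preceq> z" "level z = level x" using skel_same_level by blast
  have tz: "apex x \<preceq> z" by (rule apex_le[OF z(1,2) ne])
  have "?A \<subseteq> missed z - missed x"
  proof
    fix y assume y: "y \<in> ?A"
    then have "y \<preceq> x" using t_le by blast
    then have "y \<preceq> apex x" using t_le[OF tp(2)] le_trans by blast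
    then have "\<not> t y z" using y tz t_convex by blast
    then show "y \<in> missed z - missed x"
      using y \<open>y \<preceq> x\<close> le_trans[OF _ z(2)] by (simp add: missed_def)
  qed
  then have "card ?A \<le> card (missed z - missed x)" by (rule card_mono[rotated]) simp
  also have "\<dots> = card (missed z) - card (missed x)"
    by (rule card_Diff_subset[OF finite_missed missed_mono[OF z(2)]])
  finally have "card ?A \<le> card (missed z) - card (missed x)" .
  then have "card ?A * N \<le> (card (missed z) - card (missed x)) * N" by (rule mult_le_mono1)
  also have "\<dots> = card (missed z) * N - card (missed x) * N" by (rule diff_mult_distrib)
  also have "\<dots> < card V"
    by (rule div_eq_imp_diff_less)
      (use z card_V_pos[OF skel_V[OF z(1)]] missed_mono[OF z(2)] in \<open>auto simp: level_def card_mono\<close>)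
  finally show ?thesis by (simp add: mult.commute)
qed

end

text \<open>
  Types of vertices relative to a tree with nodes \<open>{..<m}\<close> and parent map \<open>p\<close>. A vertex of type \<open>Inl X\<close>
  is represented by the subtree \<open>X\<close>. A vertex of type \<open>Inr s\<close> may be adjacent to an arbitrary set of
  vertices whose subtrees contain the node \<open>s\<close>, and to nothing else.
\<close>

fun conflict :: "nat set + nat \<Rightarrow> nat set + nat \<Rightarrow> bool \<Rightarrow> bool" where
  "conflict (Inl X) (Inl Y) b \<longleftrightarrow> b \<noteq> (X \<inter> Y \<noteq> {})"
| "conflict (Inl X) (Inr s) b \<longleftrightarrow> b \<and> s \<notin> X"
| "conflict (Inr s) (Inl X) b \<longleftrightarrow> b \<and> s \<notin> X"
| "conflict (Inr s) (Inr s') b \<longleftrightarrow> b"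

text \<open>The least node serves as the root. The descent condition \<open>p i < i\<close> is
  imposed here, so parent maps can range over all functions. The empty set qualifies; as a type it
  stands for isolated vertices.\<close>

definition subtree :: "(nat \<Rightarrow> nat) \<Rightarrow> nat set \<Rightarrow> bool" where
  "subtree p X \<longleftrightarrow> (\<forall>i\<in>X. i \<noteq> Min X \<longrightarrow> p i \<in> X \<and> p i < i)"

definition types :: "nat \<Rightarrow> (nat \<Rightarrow> nat) \<Rightarrow> (nat set + nat) set" where
  "types m p = Inl ` {X. X \<subseteq> {..<m} \<and> subtree p X} \<union> Inr ` {..<m}"

text \<open>Ordered pairs, so each wrongly predicted edge or non-edge counts twice.\<close>

definition conflicts :: "nat \<Rightarrow> nat set set \<Rightarrow> (nat \<Rightarrow> nat set + nat) \<Rightarrow> (nat \<times> nat) set" where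
  "conflicts n E \<sigma> = {(u, v). u < n \<and> v < n \<and> u \<noteq> v \<and> conflict (\<sigma> u) (\<sigma> v) ({u, v} \<in> E)}"

lemma conflict_commute: "conflict k l b \<longleftrightarrow> conflict l k b"
  by (cases k; cases l) (auto simp: Int_commute)

section \<open>Encoding a subtree model by types\<close>

context subtree_model
begin

text \<open>The proper skeleton ancestors of \<open>x\<close> form a chain, so the one of largest
  rank is the nearest.\<close>

definition pred :: "'a \<Rightarrow> 'a" where "pred x = (ARG_MAX f z. z \<in> skel \<and> z \<preceq> x \<and> z \<noteq> x)"

lemma pred:
  assumes "z \<in> skel" "z \<preceq> x" "z \<noteq> x"
  shows "pred x \<in> skel" "pred x \<preceq> x" "pred x \<noteq> x" "z \<preceq> pred x"
proof -
  let ?P = "\<lambda>z. z \<in> skel \<and> z \<preceq> x \<and> z \<noteq> x"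
  have bound: "\<forall>y. ?P y \<longrightarrow> f y < Suc (Max (f ` V))"
    using finite_V skel_V by (simp add: le_imp_less_Suc)
  have P: "?P (pred x)" unfolding pred_def by (rule arg_max_natI[OF _ bound]) (use assms in auto)
  have "f z \<le> f (pred x)" unfolding pred_def by (rule arg_max_nat_le[OF _ bound]) (use assms in auto)
  moreover have "z \<preceq> pred x \<or> pred x \<preceq> z" using le_chain P assms by blast
  ultimately show "z \<preceq> pred x" using le_antisym by blast
  show "pred x \<in> skel" "pred x \<preceq> x" "pred x \<noteq> x" using P by auto
qed

text \<open>Numbering by rank gives ancestors the smaller numbers, as \<open>subtree\<close>
  demands.\<close>

definition index :: "'a \<Rightarrow> nat" where "index s = card {s' \<in> skel. f s' < f s}"

lemma index_less: "s \<in> skel \<Longrightarrow> f s < f s' \<Longrightarrow> index s < index s'"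
  unfolding index_def using finite_skel by (intro psubset_card_mono) auto

lemma index_lt_card: "s \<in> skel \<Longrightarrow> index s < card skel"
  unfolding index_def using finite_skel by (intro psubset_card_mono) auto

lemma index_inj: "inj_on index skel"
proof (rule inj_onI)
  fix s s' assume s: "s \<in> skel" "s' \<in> skel" and eq: "index s = index s'"
  then have "f s = f s'" using index_less[of s s'] index_less[of s' s] by (metis less_irrefl nat_neq_iff)
  then show "s = s'" using s skel_V inj_f by (auto dest: inj_onD)
qed

lemma index_meets:
  "index ` footprint x \<inter> index ` footprint y \<noteq> {} \<longleftrightarrow> footprint x \<inter> footprint y \<noteq> {}"
  using index_inj unfolding footprint_def by (auto dest: inj_onD)

text \<open>At roots and at numbers that are not indices of skeleton nodes the value is arbitrary;
  the guard with default 0 keeps it inside \<open>{..<m}\<close>.\<close>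

definition parent :: "nat \<Rightarrow> nat \<Rightarrow> nat" where
  "parent m = (\<lambda>i\<in>{..<m}. let j = index (pred (inv_into skel index i)) in if j < m then j else 0)"

text \<open>A subtree that meets the skeleton is replaced by its trace. A vertex whose subtree does
  not is attached to its nearest skeleton ancestor, or isolated if there is none.\<close>

definition code :: "'a \<Rightarrow> nat set + nat" where
  "code x = (if footprint x = {} then
     if \<exists>z\<in>skel. z \<preceq> x then Inr (index (pred x)) else Inl {}
   else Inl (index ` footprint x))"

lemma skel_footprint: "x \<in> skel \<Longrightarrow> footprint x \<noteq> {}"
  using t_refl by (auto simp: footprint_def)

text \<open>The least index in a trace belongs to the apex. For any other trace node
  \<open>s\<close>, the nearest proper skeleton ancestor lies between \<open>x\<close> and
  \<open>s\<close>, because \<open>apex x\<close> is above \<open>s\<close>; so it is in the trace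
  by convexity.\<close>

lemma code_in_types:
  assumes m: "card skel \<le> m"
  shows "code x \<in> types m (parent m)"
proof (cases "footprint x = {}")
  case True
  show ?thesis
  proof (cases "\<exists>z\<in>skel. z \<preceq> x")
    case z: True
    then have "pred x \<in> skel" using True skel_footprint pred(1) by metis
    then show ?thesis using z True index_lt_card m by (force simp: code_def types_def)
  next
    case False
    then show ?thesis using True by (auto simp: code_def types_def subtree_def)
  qed
next
  case False
  let ?X = "index ` footprint x"
  have ap: "apex x \<in> skel" "t x (apex x)" using apex[OF False] by (auto simp: footprint_def)
  have fp_skel: "s \<in> skel" "t x s" "x \<preceq> s" if "s \<in> footprint x" for s
    using that t_le by (auto simp: footprint_def)
  have Min: "Min ?X = index (apex x)"
  proof (rule Min_eqI)
    show "finite ?X" using finite_footprint by simp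
    show "index (apex x) \<in> ?X" using ap by (auto simp: footprint_def)
    fix i assume "i \<in> ?X"
    then obtain s where s: "s \<in> footprint x" "i = index s" by blast
    have "f (apex x) \<le> f s" by (rule apex(2)[OF False s(1)])
    then show "index (apex x) \<le> i"
      using finite_skel unfolding s(2) index_def by (intro card_mono) auto
  qed
  have "subtree (parent m) ?X"
    unfolding subtree_def Min
  proof (intro ballI impI)
    fix i assume "i \<in> ?X" and ne: "i \<noteq> index (apex x)"
    then obtain s where s: "s \<in> footprint x" "i = index s" by blast
    note fs = fp_skel[OF s(1)]
    have le: "apex x \<preceq> s" by (rule apex_le[OF fs(1,3) False])
    have "apex x \<noteq> s" using ne s by auto
    note pr = pred[OF ap(1) le this]
    have "x \<preceq> pred s" using t_le[OF ap(2)] pr(4) le_trans by blast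
    then have fp: "pred s \<in> footprint x" using t_convex[OF fs(2)] pr(1,2) by (auto simp: footprint_def)
    have lt: "index (pred s) < index s" using index_less[OF pr(1)] le_rank pr(2,3) by blast
    have "index s < m" using index_lt_card[OF fs(1)] m by simp
    then have "parent m i = index (pred s)"
      using lt s index_inj fs(1) by (simp add: parent_def Let_def inv_into_f_f)
    then show "parent m i \<in> ?X \<and> parent m i < i" using fp lt s by simp
  qed
  moreover have "?X \<subseteq> {..<m}" using fp_skel index_lt_card m by fastforce
  ultimately show ?thesis using False by (simp add: code_def types_def)
qed

lemma parent_PiE: "m > 0 \<Longrightarrow> parent m \<in> {..<m} \<rightarrow>\<^sub>E {..<m}"
  by (auto simp: parent_def Let_def)

text \<open>
  The edges deleted when every subtree is replaced by its trace on the skeleton.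
\<close>

definition loss :: "('a \<times> 'a) set" where
  "loss = {(y, x). y \<in> V \<and> x \<in> V \<and> t y x \<and>
     (\<not> (\<exists>z\<in>skel. y \<preceq> z \<and> z \<preceq> x) \<or> footprint x \<noteq> {} \<and> \<not> t y (apex x))}"

text \<open>Every conflict is an edge that has been given up. Traces that meet prove adjacency,
  since both roots are ancestors of a common node and hence comparable. If \<open>x\<close> has an
  empty trace but a skeleton node lies between \<open>y\<close> and its neighbour \<open>x\<close>,
  then \<open>pred x\<close> is in the trace of \<open>y\<close>, so the edge is permitted.\<close>

lemma conflict_imp_loss:
  assumes V: "y \<in> V" "x \<in> V" and yx: "f y < f x"
    and con: "conflict (code y) (code x) (t y x \<or> t x y)"
  shows "(y, x) \<in> loss"
proof (cases "footprint y = {}")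
  case True
  have nt: "\<not> t x y" using t_le[of x y] le_rank'[of x y] yx by auto
  have "t y x" using con True nt by (cases "code x") (auto simp: code_def split: if_splits)
  moreover have "\<not> (\<exists>z\<in>skel. y \<preceq> z \<and> z \<preceq> x)"
    using True t_convex[OF \<open>t y x\<close>] by (auto simp: footprint_def)
  ultimately show ?thesis using V by (simp add: loss_def)
next
  case False
  have nt: "\<not> t x y" using t_le[of x y] le_rank'[of x y] yx by auto
  show ?thesis
  proof (cases "footprint x = {}")
    case True
    have tyx: "t y x" using con False True nt by (auto simp: code_def split: if_splits)
    moreover have "\<not> (\<exists>z\<in>skel. y \<preceq> z \<and> z \<preceq> x)"
    proof
      assume "\<exists>z\<in>skel. y \<preceq> z \<and> z \<preceq> x"
      then obtain z where z: "z \<in> skel" "y \<preceq> z" "z \<preceq> x" by blast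
      have "z \<noteq> x" using z(1) True skel_footprint by blast
      note pr = pred[OF z(1,3) this]
      have "y \<preceq> pred x" using z(2) pr(4) le_trans by blast
      then have "pred x \<in> footprint y" using t_convex[OF tyx] pr by (auto simp: footprint_def)
      then show False using con False True z by (auto simp: code_def split: if_splits)
    qed
    ultimately show ?thesis using V by (simp add: loss_def)
  next
    case nx: False
    have "t y x \<noteq> (footprint y \<inter> footprint x \<noteq> {})"
      using con False nx nt by (simp add: code_def index_meets)
    moreover have "t y x" if "footprint y \<inter> footprint x \<noteq> {}"
    proof -
      obtain s where s: "t y s" "t x s" using \<open>footprint y \<inter> footprint x \<noteq> {}\<close> by (auto simp: footprint_def)
      then have "y \<preceq> x" using le_chain[OF t_le t_le] le_rank'[of x y] yx by fastforce
      then show ?thesis using t_convex s t_le by blast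
    qed
    ultimately have "t y x" "footprint y \<inter> footprint x = {}" by auto
    moreover have "apex x \<in> footprint x" by (rule apex(1)[OF nx])
    ultimately show ?thesis using nx V by (auto simp: loss_def footprint_def)
  qed
qed

text \<open>Lost pairs of the first kind are counted by their upper vertex \<open>y\<close>, those
  of the second kind by their lower vertex \<open>x\<close>.\<close>

lemma card_loss: "N * card loss \<le> 2 * (card V)\<^sup>2"
proof -
  define A where "A y = {x \<in> V. y \<preceq> x \<and> \<not> (\<exists>z\<in>skel. y \<preceq> z \<and> z \<preceq> x)}" for y
  define B where "B x = {y \<in> V. footprint x \<noteq> {} \<and> t y x \<and> \<not> t y (apex x)}" for x
  have fin: "finite (A y)" "finite (B y)" for y using finite_V by (auto simp: A_def B_def)
  have sub: "loss \<subseteq> Sigma V A \<union> (\<lambda>(x, y). (y, x)) ` Sigma V B"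
    using t_le by (force simp: loss_def A_def B_def)
  have "card loss \<le> card (Sigma V A \<union> (\<lambda>(x, y). (y, x)) ` Sigma V B)"
    using finite_V fin sub by (intro card_mono) auto
  also have "\<dots> \<le> card (Sigma V A) + card ((\<lambda>(x, y). (y, x)) ` Sigma V B)" by (rule card_Un_le)
  also have "\<dots> \<le> card (Sigma V A) + card (Sigma V B)"
    using finite_V fin by (intro add_left_mono card_image_le) auto
  also have "\<dots> = (\<Sum>y\<in>V. card (A y)) + (\<Sum>x\<in>V. card (B x))" using finite_V fin by simp
  finally have "N * card loss \<le> N * ((\<Sum>y\<in>V. card (A y)) + (\<Sum>x\<in>V. card (B x)))"
    by (rule mult_le_mono2)
  also have "\<dots> = (\<Sum>y\<in>V. N * card (A y)) + (\<Sum>x\<in>V. N * card (B x))"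
    by (simp add: distrib_left sum_distrib_left)
  also have "\<dots> \<le> (\<Sum>y\<in>V. card V) + (\<Sum>x\<in>V. card V)"
  proof (intro add_mono sum_mono)
    show "N * card (A y) \<le> card V" if "y \<in> V" for y using lost_descendants[OF that] by (simp add: A_def)
    show "N * card (B x) \<le> card V" for x
      using lost_ancestors[of x] by (cases "footprint x = {}") (auto simp: B_def)
  qed
  finally show ?thesis by (simp add: power2_eq_square)
qed

lemma card_conflict:
  "N * card {(u, v). u \<in> V \<and> v \<in> V \<and> u \<noteq> v \<and> conflict (code u) (code v) (t u v \<or> t v u)}
     \<le> 4 * (card V)\<^sup>2" (is "N * card ?C \<le> _")
proof -
  have fin: "finite loss" 
    by (rule finite_subset[of _ "V \<times> V"]) (use finite_V in \<open>auto simp only: loss_def mem_Times_iff fst_conv snd_conv\<close>)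
  have "?C \<subseteq> loss \<union> (\<lambda>(x, y). (y, x)) ` loss"
  proof (rule subsetI, clarify)
    fix u v assume *: "u \<in> V" "v \<in> V" "u \<noteq> v" "conflict (code u) (code v) (t u v \<or> t v u)"
      "(u, v) \<notin> (\<lambda>(x, y). (y, x)) ` loss"
    then have "f u \<noteq> f v" using inj_f by (auto dest: inj_onD)
    then consider "f u < f v" | "f v < f u" by linarith
    then show "(u, v) \<in> loss"
    proof cases
      case 2
      have "conflict (code v) (code u) (t v u \<or> t u v)"
        using *(4) by (subst conflict_commute) (simp add: disj_commute)
      from conflict_imp_loss[OF *(2,1) 2 this] show ?thesis using *(5) by force
    qed (use conflict_imp_loss * in auto)
  qed
  then have "card ?C \<le> card (loss \<union> (\<lambda>(x, y). (y, x)) ` loss)" using fin by (intro card_mono) auto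
  also have "\<dots> \<le> card loss + card ((\<lambda>(x, y). (y, x)) ` loss)" by (rule card_Un_le)
  also have "\<dots> \<le> 2 * card loss" using card_image_le[OF fin] by (simp add: mult_2)
  finally have "N * card ?C \<le> N * (2 * card loss)" by (rule mult_le_mono2)
  also have "\<dots> = 2 * (N * card loss)" by simp
  also have "\<dots> \<le> 2 * (2 * (card V)\<^sup>2)" using card_loss by (rule mult_le_mono2)
  finally show ?thesis by simp
qed

end

section \<open>Distance to chordality as a minimal assignment cost\<close>

text \<open>The parent of \<open>x\<close> is its earlier neighbour \<open>q\<close> of largest
  rank; by the clique condition the other earlier neighbours of \<open>x\<close> are earlier
  neighbours of \<open>q\<close>. Hence the ancestors of a vertex form a chain. The subtree of
  \<open>y\<close> consists of \<open>y\<close> and its later neighbours.\<close>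

lemma elimination_order_subtree_model:
  fixes f :: "'a \<Rightarrow> nat"
  assumes "finite V" and inj: "inj_on f V"
    and clique: "\<And>v x y. v \<in> V \<Longrightarrow> x \<in> V \<Longrightarrow> y \<in> V \<Longrightarrow> {v, x} \<in> E \<Longrightarrow> {v, y} \<in> E \<Longrightarrow>
      f x < f v \<Longrightarrow> f y < f v \<Longrightarrow> x \<noteq> y \<Longrightarrow> {x, y} \<in> E"
  defines "R \<equiv> \<lambda>y x. y \<in> V \<and> x \<in> V \<and> {y, x} \<in> E \<and> f y < f x"
  shows "subtree_model V R\<^sup>*\<^sup>* (\<lambda>y x. y = x \<or> R y x) f"
proof -
  have rank: "f x < f y" if "R\<^sup>*\<^sup>* x y" "x \<noteq> y" for x y
  proof -
    have "R\<^sup>+\<^sup>+ x y" using that by (auto dest: rtranclpD)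
    then show ?thesis by induction (auto simp: R_def)
  qed
  have last_step: "\<exists>q. R q x \<and> (\<forall>y'. R y' x \<longrightarrow> y' = q \<or> R y' q) \<and> (\<forall>y. R\<^sup>*\<^sup>* y x \<longrightarrow> y \<noteq> x \<longrightarrow> R\<^sup>*\<^sup>* y q)"
    if yx: "R\<^sup>*\<^sup>* y x" and ne: "y \<noteq> x" for x y
  proof -
    obtain y0 where "R y0 x" using yx ne by (cases rule: rtranclp.cases) auto
    have "\<forall>y. R y x \<longrightarrow> f y < f x" by (simp add: R_def)
    then obtain q where q: "R q x" and max: "\<And>y. R y x \<Longrightarrow> f y \<le> f q"
      using \<open>R y0 x\<close> arg_max_natI[of "\<lambda>y. R y x" y0 f] arg_max_nat_le[of "\<lambda>y. R y x" _ f] by blast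
    have step: "y' = q \<or> R y' q" if y': "R y' x" for y'
    proof (cases "y' = q")
      case False
      have "f y' \<noteq> f q" using False q y' inj by (auto simp: R_def dest: inj_onD)
      then have "f y' < f q" using max[OF y'] by simp
      moreover have "{y', q} \<in> E"
        using clique[of x y' q] False q y' by (simp add: R_def insert_commute)
      ultimately show ?thesis using q y' by (simp add: R_def)
    qed simp
    have "R\<^sup>*\<^sup>* y q" if yx: "R\<^sup>*\<^sup>* y x" and ne: "y \<noteq> x" for y
    proof -
      obtain y' where y': "R\<^sup>*\<^sup>* y y'" "R y' x" using yx ne by (cases rule: rtranclp.cases) auto
      then show ?thesis using step[OF y'(2)] by auto
    qed
    then show ?thesis using q step by blast
  qed
  have chain: "R\<^sup>*\<^sup>* x z \<Longrightarrow> R\<^sup>*\<^sup>* y z \<Longrightarrow> R\<^sup>*\<^sup>* x y \<or> R\<^sup>*\<^sup>* y x" for x y z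
  proof (induction z rule: measure_induct_rule[of f])
    case (less z)
    show ?case
    proof (cases "x = z \<or> y = z")
      case False
      obtain q where q: "R q z" "\<forall>y. R\<^sup>*\<^sup>* y z \<longrightarrow> y \<noteq> z \<longrightarrow> R\<^sup>*\<^sup>* y q"
        using last_step[of x z] less.prems False by blast
      then show ?thesis using less.IH[of q] less.prems False by (auto simp: R_def)
    qed (use less.prems in auto)
  qed
  \<comment> \<open>If \<open>z\<close> differs from \<open>x\<close>, then \<open>x\<close> may be
    replaced by its parent \<open>q\<close>: \<open>z\<close> is still above or equal to it, and
    \<open>y\<close> is \<open>q\<close> or an earlier neighbour of it.\<close>
  have convex: "R y x \<Longrightarrow> R\<^sup>*\<^sup>* y z \<Longrightarrow> R\<^sup>*\<^sup>* z x \<Longrightarrow> y = z \<or> R y z" for x y z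
  proof (induction x rule: measure_induct_rule[of f])
    case (less x)
    show ?case
    proof (cases "z = x")
      case False
      obtain q where q: "R q x" "\<forall>y'. R y' x \<longrightarrow> y' = q \<or> R y' q" "\<forall>y. R\<^sup>*\<^sup>* y x \<longrightarrow> y \<noteq> x \<longrightarrow> R\<^sup>*\<^sup>* y q"
        using last_step[OF less.prems(3) False] by blast
      have zq: "R\<^sup>*\<^sup>* z q" using q(3) less.prems(3) False by blast
      show ?thesis
      proof (cases "y = q")
        case True
        then show ?thesis using rank[of y z] rank[of z y] zq less.prems(2) by force
      next
        case False
        then have "R y q" using q(2) less.prems(1) by blast
        moreover have "f q < f x" using q(1) by (simp add: R_def)
        ultimately show ?thesis using less.IH less.prems(2) zq by blast
      qed
    qed (use less.prems in auto)
  qed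
  have closed: "x \<in> V" if "R\<^sup>*\<^sup>* x y" "y \<in> V" for x y
    using that by (metis R_def converse_rtranclpE)
  show ?thesis
  proof
    show "finite V" "inj_on f V" by fact+
    show "R\<^sup>*\<^sup>* x y \<Longrightarrow> x \<noteq> y \<Longrightarrow> f x < f y" for x y by (rule rank)
    show "R\<^sup>*\<^sup>* x y \<Longrightarrow> y \<in> V \<Longrightarrow> x \<in> V" for x y by (rule closed)
    show "R\<^sup>*\<^sup>* x z \<Longrightarrow> R\<^sup>*\<^sup>* y z \<Longrightarrow> R\<^sup>*\<^sup>* x y \<or> R\<^sup>*\<^sup>* y x" for x y z by (rule chain)
    show "R\<^sup>*\<^sup>* x y \<Longrightarrow> R\<^sup>*\<^sup>* y z \<Longrightarrow> R\<^sup>*\<^sup>* x z" for x y z by simp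
    show "y = x \<or> R y x \<Longrightarrow> R\<^sup>*\<^sup>* y x" for x y by auto
    show "y = x \<or> R y x \<Longrightarrow> R\<^sup>*\<^sup>* y z \<Longrightarrow> R\<^sup>*\<^sup>* z x \<Longrightarrow> y = z \<or> R y z" for x y z
      using convex rank by (metis less_asym)
  qed simp_all
qed

lemma chordal_compression:
  assumes E: "simple_graph n E" "chordal E" and N: "N > 0" and m: "N * (N + 1)\<^sup>2 \<le> m"
  shows "\<exists>p\<in>{..<m} \<rightarrow>\<^sub>E {..<m}. \<exists>\<sigma>. (\<forall>v. \<sigma> v \<in> types m p) \<and> N * card (conflicts n E \<sigma>) \<le> 4 * n\<^sup>2"
proof -
  have no_loops: "{x} \<notin> E" for x using E(1) by (force simp: simple_graph_def)
  obtain f :: "nat \<Rightarrow> nat" where f: "inj_on f {..<n}"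
    "\<forall>v\<in>{..<n}. \<forall>x\<in>{..<n}. \<forall>y\<in>{..<n}.
      {v, x} \<in> E \<longrightarrow> {v, y} \<in> E \<longrightarrow> f x < f v \<longrightarrow> f y < f v \<longrightarrow> x \<noteq> y \<longrightarrow> {x, y} \<in> E"
    using chordal_elimination_order[OF E(2) no_loops, of "{..<n}"] by auto
  define R where "R = (\<lambda>y x. y \<in> {..<n} \<and> x \<in> {..<n} \<and> {y, x} \<in> E \<and> f y < f x)"
  interpret subtree_model "{..<n}" "R\<^sup>*\<^sup>*" "\<lambda>y x. y = x \<or> R y x" f N
    unfolding R_def
  proof (rule elimination_order_subtree_model[OF _ f(1)])
    show "{x, y} \<in> E" if "v \<in> {..<n}" "x \<in> {..<n}" "y \<in> {..<n}" "{v, x} \<in> E" "{v, y} \<in> E"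
      "f x < f v" "f y < f v" "x \<noteq> y" for v x y
      using f(2) that by meson
  qed simp
  have "{(u, v). u \<in> {..<n} \<and> v \<in> {..<n} \<and> u \<noteq> v \<and>
      conflict (code u) (code v) ((u = v \<or> R u v) \<or> (v = u \<or> R v u))} = conflicts n E code"
  proof -
    have "((u = v \<or> R u v) \<or> (v = u \<or> R v u)) \<longleftrightarrow> {u, v} \<in> E" if "u < n" "v < n" "u \<noteq> v" for u v
    proof -
      have "f u \<noteq> f v" using inj_onD[OF f(1), of u v] that by auto
      then have "f u < f v \<or> f v < f u" by linarith
      then show ?thesis using that by (auto simp: R_def insert_commute)
    qed
    then show ?thesis by (auto simp: conflicts_def)
  qed
  then have "N * card (conflicts n E code) \<le> 4 * n\<^sup>2" using card_conflict by simp
  moreover have "card skel \<le> m" using card_skel m by simp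
  moreover have "m > 0" using N m by (cases m) auto
  ultimately show ?thesis using parent_PiE code_in_types by blast
qed

section \<open>From assignments of types back to chordal graphs\<close>

lemma card_ordered_pairs:
  fixes F :: "'a set set"
  assumes "finite F" and F: "\<And>e. e \<in> F \<Longrightarrow> card e = 2"
  shows "card {(u, v). {u, v} \<in> F} = 2 * card F"
proof -
  have pairs: "finite {(u, v). {u, v} = e} \<and> card {(u, v). {u, v} = e} = 2" if "e \<in> F" for e
  proof -
    have "card e = 2" using F that by blast
    then obtain a b where ab: "e = {a, b}" "a \<noteq> b" by (auto simp: card_2_iff)
    then have "{(u, v). {u, v} = e} = {(a, b), (b, a)}" by (auto simp: doubleton_eq_iff)
    then show ?thesis using ab by simp
  qed
  have "{(u, v). {u, v} \<in> F} = (\<Union>e\<in>F. {(u, v). {u, v} = e})" by auto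
  also have "card \<dots> = (\<Sum>e\<in>F. card {(u, v). {u, v} = e})"
    using assms(1) pairs by (intro card_UN_disjoint) auto
  finally show ?thesis using pairs by simp
qed

text \<open>The least common node \<open>i\<close> is the root of \<open>Z\<close>: otherwise it is
  the root of neither set, and its parent is a smaller common node.\<close>

lemma subtree_Min_mem:
  assumes X: "finite X" "subtree p X" and Z: "finite Z" "subtree p Z"
    and meet: "X \<inter> Z \<noteq> {}" and le: "Min X \<le> Min Z"
  shows "Min Z \<in> X"
proof -
  define i where "i = Min (X \<inter> Z)"
  have i: "i \<in> X" "i \<in> Z" using Min_in[of "X \<inter> Z"] X meet by (auto simp: i_def)
  have "i = Min Z"
  proof (rule ccontr)
    assume ne: "i \<noteq> Min Z"
    then have p: "p i \<in> Z" "p i < i" using Z i by (auto simp: subtree_def)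
    have "Min Z \<le> i" using Z i by simp
    then have "i \<noteq> Min X" using le ne by simp
    then have "p i \<in> X" using X i by (auto simp: subtree_def)
    then have "i \<le> p i" using p(1) X(1) Min_le[of "X \<inter> Z" "p i"] by (simp add: i_def)
    then show False using p by simp
  qed
  then show ?thesis using i by simp
qed

text \<open>Flipping exactly the conflicting pairs gives a graph \<open>E'\<close> that obeys the
  types. Around each \<open>v\<close>, all neighbours of no larger rank have subtrees through one
  node, namely the root of the subtree of \<open>v\<close> or the node to which \<open>v\<close> is
  attached. So they are pairwise adjacent and \<open>chordal_rankI\<close> applies.\<close>

lemma repair_conflicts:
  assumes E: "simple_graph n E" and \<sigma>: "\<And>v. v < n \<Longrightarrow> \<sigma> v \<in> types m p"
  shows "\<exists>E'. simple_graph n E' \<and> chordal E' \<and>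
    2 * (card (E - E') + card (E' - E)) = card (conflicts n E \<sigma>)"
proof -
  let ?c = "\<lambda>u v. conflict (\<sigma> u) (\<sigma> v) ({u, v} \<in> E)"
  define E' where "E' = {{u, v} | u v. u < n \<and> v < n \<and> u \<noteq> v \<and> ({u, v} \<in> E) \<noteq> ?c u v}"
  have E'_simple: "simple_graph n E'" by (auto simp: simple_graph_def E'_def)
  have c_commute: "?c u v \<longleftrightarrow> ?c v u" for u v
    by (metis conflict_commute insert_commute)
  have mem: "{u, v} \<in> E' \<longleftrightarrow> u < n \<and> v < n \<and> u \<noteq> v \<and> ({u, v} \<in> E) \<noteq> ?c u v" for u v
  proof -
    have "u < n \<and> v < n \<and> u \<noteq> v \<and> ({u, v} \<in> E) \<noteq> ?c u v" if "{u, v} \<in> E'"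
    proof -
      obtain a b where ab: "{u, v} = {a, b}" "a < n" "b < n" "a \<noteq> b" "({a, b} \<in> E) \<noteq> ?c a b"
        using \<open>{u, v} \<in> E'\<close> unfolding E'_def by blast
      then consider "u = a" "v = b" | "u = b" "v = a" by (auto simp: doubleton_eq_iff)
      then show ?thesis using ab c_commute[of a b] by cases (simp_all add: insert_commute)
    qed
    then show ?thesis unfolding E'_def by blast
  qed
  have core: "{x, y} \<in> E' \<longleftrightarrow> X \<inter> Y \<noteq> {}"
    if "x < n" "y < n" "x \<noteq> y" "\<sigma> x = Inl X" "\<sigma> y = Inl Y" for x y X Y
    using that by (auto simp: mem)
  have leaf: "\<exists>X. \<sigma> x = Inl X \<and> s \<in> X" if "{v, x} \<in> E'" "\<sigma> v = Inr s" for v x s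
    using that by (cases "\<sigma> x") (auto simp: mem)
  \<comment> \<open>Rank \<open>m\<close> exceeds all nodes and puts the attached vertices last. The
    rank at type \<open>Inl {}\<close> is unspecified, but such a vertex is isolated in
    \<open>E'\<close>.\<close>
  define \<rho> where "\<rho> v = (case \<sigma> v of Inl X \<Rightarrow> Min X | Inr s \<Rightarrow> m)" for v
  have anchor: "\<exists>i. \<forall>x. {v, x} \<in> E' \<longrightarrow> \<rho> x \<le> \<rho> v \<longrightarrow> (\<exists>X. \<sigma> x = Inl X \<and> i \<in> X)" for v
  proof (cases "\<sigma> v")
    case (Inr s)
    then show ?thesis using leaf by blast
  next
    case (Inl Z)
    have "\<exists>X. \<sigma> x = Inl X \<and> Min Z \<in> X" if x: "{v, x} \<in> E'" "\<rho> x \<le> \<rho> v" for x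
    proof -
      have lt: "v < n" "x < n" "v \<noteq> x" using x(1) by (auto simp: mem)
      have Z: "Z \<subseteq> {..<m}" "subtree p Z" "finite Z"
        using \<sigma>[OF lt(1)] Inl by (auto simp: types_def intro: finite_subset)
      show ?thesis
      proof (cases "\<sigma> x")
        case (Inr s)
        have "{x, v} \<in> E'" using x(1) by (simp add: insert_commute)
        then have "s \<in> Z" using leaf[OF _ Inr, of v] Inl by auto
        then have "Min Z \<in> {..<m}" using Z Min_in[of Z] by blast
        then show ?thesis using x(2) Inr Inl by (simp add: \<rho>_def)
      next
        case X: (Inl X)
        have "X \<subseteq> {..<m}" "subtree p X" "finite X"
          using \<sigma>[OF lt(2)] X by (auto simp: types_def intro: finite_subset)
        moreover have "Z \<inter> X \<noteq> {}" using core[OF lt Inl X] x(1) by simp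
        ultimately show ?thesis
          using subtree_Min_mem[of X p Z] Z x(2) Inl X by (simp add: \<rho>_def Int_commute)
      qed
    qed
    then show ?thesis by blast
  qed
  have "chordal E'"
  proof (rule chordal_rankI[of _ \<rho>])
    fix v x y assume *: "{v, x} \<in> E'" "{v, y} \<in> E'" "x \<noteq> y" "\<rho> x \<le> \<rho> v" "\<rho> y \<le> \<rho> v"
    obtain i where i: "\<forall>x. {v, x} \<in> E' \<longrightarrow> \<rho> x \<le> \<rho> v \<longrightarrow> (\<exists>X. \<sigma> x = Inl X \<and> i \<in> X)"
      using anchor by blast
    then obtain X Y where "\<sigma> x = Inl X" "i \<in> X" "\<sigma> y = Inl Y" "i \<in> Y" using * by meson
    moreover have "x < n" "y < n" using * by (auto simp: mem)
    ultimately show "{x, y} \<in> E'" using core[of x y X Y] *(3) by blast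
  qed
  moreover have "2 * (card (E - E') + card (E' - E)) = card (conflicts n E \<sigma>)"
  proof -
    have sub: "E \<subseteq> Pow {..<n}" "E' \<subseteq> Pow {..<n}" using E E'_simple by (auto simp: simple_graph_def)
    then have fin: "finite E" "finite E'" by (auto intro: finite_subset)
    define F where "F = (E - E') \<union> (E' - E)"
    have two: "card e = 2" if "e \<in> F" for e
      using that E E'_simple by (auto simp: F_def simple_graph_def)
    have "{(u, v). {u, v} \<in> F} = conflicts n E \<sigma>"
    proof -
      have "{u, v} \<in> F \<longleftrightarrow> (u, v) \<in> conflicts n E \<sigma>" for u v
      proof -
        have "u < n \<and> v < n \<and> u \<noteq> v" if "{u, v} \<in> F"
          using that two[OF that] E E'_simple by (cases "u = v") (auto simp: F_def simple_graph_def)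
        then show ?thesis by (auto simp: F_def mem conflicts_def)
      qed
      then show ?thesis by auto
    qed
    moreover have "card F = card (E - E') + card (E' - E)"
      unfolding F_def using fin by (intro card_Un_disjoint) auto
    ultimately show ?thesis using card_ordered_pairs[of F] two fin by (simp add: F_def)
  qed
  ultimately show ?thesis using E'_simple by blast
qed

abbreviation dist_chordal :: "nat \<Rightarrow> nat set set \<Rightarrow> real" where
  "dist_chordal n E \<equiv> dist_to_property n E (\<lambda>n E. chordal E)"

lemma finite_simple_graphs: "finite {E. simple_graph n E \<and> P E}"
  by (rule finite_subset[of _ "Pow (Pow {..<n})"]) (auto simp: simple_graph_def)

lemma dist_chordal_le:
  assumes E: "simple_graph n E" and \<sigma>: "\<And>v. v < n \<Longrightarrow> \<sigma> v \<in> types m p"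
  shows "dist_chordal n E \<le> card (conflicts n E \<sigma>) / real n ^ 2 / 2"
proof -
  obtain E' where E': "simple_graph n E'" "chordal E'"
    "2 * (card (E - E') + card (E' - E)) = card (conflicts n E \<sigma>)"
    using repair_conflicts[OF E, of \<sigma> m p] \<sigma> by blast
  have "dist_chordal n E \<le> graph_dist n E E'"
    unfolding dist_to_property_def using E' finite_simple_graphs by (intro Min_le) auto
  also have "\<dots> = real (2 * (card (E - E') + card (E' - E))) / real n ^ 2 / 2"
    by (simp add: graph_dist_def add_divide_distrib)
  finally show ?thesis by (simp only: E'(3))
qed

text \<open>The assignment comes from a nearest chordal graph \<open>E'\<close>. Against
  \<open>E\<close> it has conflicts only at its conflicts with \<open>E'\<close> and at the ordered
  pairs in which \<open>E\<close> and \<open>E'\<close> differ; the \<open>4 / N\<close> of the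
  compression is halved with the rest.\<close>

lemma dist_chordal_ge:
  fixes n N m :: nat
  assumes E: "simple_graph n E" and n: "n > 0" and N: "N > 0" and m: "N * (N + 1)\<^sup>2 \<le> m"
  shows "\<exists>p\<in>{..<m} \<rightarrow>\<^sub>E {..<m}. \<exists>\<sigma>. (\<forall>v. \<sigma> v \<in> types m p) \<and>
    card (conflicts n E \<sigma>) / real n ^ 2 / 2 \<le> dist_chordal n E + 2 / N"
proof -
  have "simple_graph n {}" "chordal {}"
    by (auto simp: simple_graph_def chordal_def is_cycle_def)
  then have "{E'. simple_graph n E' \<and> chordal E'} \<noteq> {}" by blast
  then have "dist_chordal n E \<in> graph_dist n E ` {E'. simple_graph n E' \<and> chordal E'}"
    unfolding dist_to_property_def using finite_simple_graphs by (intro Min_in) auto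
  then obtain E' where E': "simple_graph n E'" "chordal E'" "dist_chordal n E = graph_dist n E E'"
    by auto
  obtain p \<sigma> where p: "p \<in> {..<m} \<rightarrow>\<^sub>E {..<m}" "\<forall>v. \<sigma> v \<in> types m p"
    and con: "N * card (conflicts n E' \<sigma>) \<le> 4 * n\<^sup>2"
    using chordal_compression[OF E'(1,2) N m] by blast
  have sub: "E \<subseteq> Pow {..<n}" "E' \<subseteq> Pow {..<n}" using E E'(1) by (auto simp: simple_graph_def)
  then have fin: "finite E" "finite E'" by (auto intro: finite_subset)
  define F where "F = (E - E') \<union> (E' - E)"
  have "card F = card (E - E') + card (E' - E)"
    unfolding F_def using fin by (intro card_Un_disjoint) auto
  moreover have "card {(u, v). {u, v} \<in> F} = 2 * card F"
    using fin E E'(1) by (intro card_ordered_pairs) (auto simp: F_def simple_graph_def)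
  ultimately have F: "real (card {(u, v). {u, v} \<in> F}) / real n ^ 2 = 2 * dist_chordal n E"
    by (simp add: E'(3) graph_dist_def)
  have fin_conf: "finite (conflicts n E' \<sigma>)"
    by (rule finite_subset[of _ "{..<n} \<times> {..<n}"]) (auto simp: conflicts_def)
  have "{(u, v). {u, v} \<in> F} \<subseteq> {..<n} \<times> {..<n}" using sub by (auto simp: F_def)
  then have fin_F: "finite {(u, v). {u, v} \<in> F}" by (rule finite_subset) simp
  have "conflicts n E \<sigma> \<subseteq> conflicts n E' \<sigma> \<union> {(u, v). {u, v} \<in> F}"
    by (auto simp: conflicts_def F_def)
  then have "card (conflicts n E \<sigma>) \<le> card (conflicts n E' \<sigma> \<union> {(u, v). {u, v} \<in> F})"
    using fin_conf fin_F by (intro card_mono) auto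
  also have "\<dots> \<le> card (conflicts n E' \<sigma>) + card {(u, v). {u, v} \<in> F}" by (rule card_Un_le)
  finally have "real (card (conflicts n E \<sigma>)) / real n ^ 2
      \<le> (real (card (conflicts n E' \<sigma>)) + real (card {(u, v). {u, v} \<in> F})) / real n ^ 2"
    by (intro divide_right_mono) (simp_all flip: of_nat_add)
  also have "\<dots> = real (card (conflicts n E' \<sigma>)) / real n ^ 2 + 2 * dist_chordal n E"
    by (simp only: add_divide_distrib F)
  also have "real (card (conflicts n E' \<sigma>)) / real n ^ 2 \<le> 4 / N"
  proof -
    have "real N * real (card (conflicts n E' \<sigma>)) \<le> 4 * real n ^ 2"
      using con by (metis of_nat_le_iff of_nat_mult of_nat_numeral of_nat_power)
    then show ?thesis using N n by (simp add: field_simps)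
  qed
  finally show ?thesis using p by (intro bexI[of _ p] exI[of _ \<sigma>]) auto
qed

section \<open>Estimating the minimal cost of an assignment\<close>

lemma expectation_mono_finite_pmf:
  fixes f g :: "'a \<Rightarrow> real"
  assumes "finite (set_pmf p)" "\<And>x. x \<in> set_pmf p \<Longrightarrow> f x \<le> g x"
  shows "measure_pmf.expectation p f \<le> measure_pmf.expectation p g"
  using assms by (intro integral_mono_AE) (auto simp: AE_measure_pmf_iff integrable_measure_pmf_finite)

lemma expectation_pair_finite_pmf:
  fixes h :: "'a \<times> 'b \<Rightarrow> real"
  assumes "finite (set_pmf p)" "finite (set_pmf q)"
  shows "measure_pmf.expectation (pair_pmf p q) h =
    measure_pmf.expectation p (\<lambda>a. measure_pmf.expectation q (\<lambda>b. h (a, b)))"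
proof -
  have "pair_pmf p q = bind_pmf p (\<lambda>a. map_pmf (Pair a) q)"
    by (simp add: pair_pmf_def map_pmf_def)
  then have "measure_pmf.expectation (pair_pmf p q) h =
      (\<Sum>a\<in>set_pmf p. pmf p a *\<^sub>R measure_pmf.expectation (map_pmf (Pair a) q) h)"
    using assms by (simp add: pmf_expectation_bind[of "set_pmf p"])
  also have "\<dots> = measure_pmf.expectation p (\<lambda>a. measure_pmf.expectation q (\<lambda>b. h (a, b)))"
    using assms by (subst integral_measure_pmf[of "set_pmf p"]) auto
  finally show ?thesis .
qed

lemma prob_pair_pmf_le:
  assumes fin: "finite (set_pmf p)" "finite (set_pmf q)"
    and le: "\<And>x. x \<in> set_pmf p \<Longrightarrow> measure_pmf.prob q (B x) \<le> c"
  shows "measure_pmf.prob (pair_pmf p q) {(x, w). w \<in> B x} \<le> c"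
proof -
  have "measure_pmf.prob (pair_pmf p q) {(x, w). w \<in> B x} =
      measure_pmf.expectation (pair_pmf p q) (indicator {(x, w). w \<in> B x})" by simp
  also have "\<dots> = measure_pmf.expectation p (\<lambda>x. measure_pmf.expectation q (indicator (B x)))"
  proof -
    have "indicator {(x, w). w \<in> B x} (a, b) = (indicator (B a) b :: real)" for a b
      by (simp add: indicator_def)
    then show ?thesis using fin by (simp only: expectation_pair_finite_pmf)
  qed
  also have "\<dots> \<le> measure_pmf.expectation p (\<lambda>_. c)"
    using fin le by (intro expectation_mono_finite_pmf) auto
  finally show ?thesis by simp
qed

lemma prob_Markov_finite_pmf:
  fixes f :: "'a \<Rightarrow> real"
  assumes fin: "finite (set_pmf p)" and nonneg: "\<And>x. x \<in> set_pmf p \<Longrightarrow> f x \<ge> 0" and c: "c > 0"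
  shows "measure_pmf.prob p {x. f x \<ge> c} \<le> measure_pmf.expectation p f / c"
proof -
  have "c * measure_pmf.prob p {x. f x \<ge> c} = measure_pmf.expectation p (\<lambda>x. c * indicator {x. f x \<ge> c} x)"
    by simp
  also have "\<dots> \<le> measure_pmf.expectation p f"
    using fin nonneg by (intro expectation_mono_finite_pmf) (auto simp: indicator_def)
  finally show ?thesis using c by (simp add: field_simps)
qed

text \<open>The first \<open>q\<close> entries are independent and uniform; \<open>d\<close> is the
  value at all other arguments.\<close>

abbreviation uniform_tuple :: "'a \<Rightarrow> nat \<Rightarrow> 'a set \<Rightarrow> (nat \<Rightarrow> 'a) pmf" where
  "uniform_tuple d q V \<equiv> Pi_pmf {..<q} d (\<lambda>_. pmf_of_set V)"

lemma set_uniform_tuple: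
  assumes "finite V" "V \<noteq> {}"
  shows "set_pmf (uniform_tuple d q V) = PiE_dflt {..<q} d (\<lambda>_. V)"
  using assms by (simp add: set_Pi_pmf o_def)

lemma finite_set_uniform_tuple:
  assumes "finite V" "V \<noteq> {}"
  shows "finite (set_pmf (uniform_tuple d q V))"
  using assms by (simp add: set_uniform_tuple finite_PiE_dflt)

lemma Hoeffding_uniform_tuple:
  fixes g :: "'a \<Rightarrow> real"
  assumes V: "finite V" "V \<noteq> {}" and q: "q > 0" and g: "\<And>v. v \<in> V \<Longrightarrow> 0 \<le> g v \<and> g v \<le> 1"
    and \<delta>: "\<delta> \<ge> 0"
  shows "measure_pmf.prob (uniform_tuple d q V)
    {x. \<bar>(\<Sum>j<q. g (x j)) / q - (\<Sum>v\<in>V. g v) / card V\<bar> \<ge> \<delta>} \<le> 2 * exp (- 2 * real q * \<delta>\<^sup>2)"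
proof -
  let ?M = "uniform_tuple d q V"
  have comp: "map_pmf (\<lambda>x. x j) ?M = pmf_of_set V" if "j < q" for j
    using that by (simp add: Pi_pmf_component)
  have exp: "measure_pmf.expectation ?M (\<lambda>x. g (x j)) = (\<Sum>v\<in>V. g v) / card V" if "j < q" for j
  proof -
    have "measure_pmf.expectation ?M (\<lambda>x. g (x j)) = measure_pmf.expectation (map_pmf (\<lambda>x. x j) ?M) g"
      by simp
    then show ?thesis using that V by (simp add: comp integral_pmf_of_set)
  qed
  have "prob_space.indep_vars (measure_pmf ?M) (\<lambda>_. count_space UNIV) (\<lambda>j x. x j) {..<q}"
    by (rule indep_vars_Pi_pmf) simp
  then have "prob_space.indep_vars (measure_pmf ?M) (\<lambda>_. borel) (\<lambda>j. g \<circ> (\<lambda>x. x j)) {..<q}"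
    by (rule prob_space.indep_vars_compose[OF measure_pmf.prob_space_axioms]) simp
  then have indep: "prob_space.indep_vars (measure_pmf ?M) (\<lambda>_. borel) (\<lambda>j x. g (x j)) {..<q}"
    by (simp add: o_def)
  interpret Hoeffding_ineq "measure_pmf ?M" "{..<q}" "\<lambda>j x. g (x j)" "\<lambda>_. 0" "\<lambda>_. 1"
    "q * ((\<Sum>v\<in>V. g v) / card V)"
  proof (unfold_locales, goal_cases)
    case 2
    show ?case by (rule indep)
  next
    case (3 j)
    have "x j \<in> V" if "x \<in> set_pmf ?M" for x
      using that 3 V by (auto simp: set_uniform_tuple PiE_dflt_def)
    then show ?case using g by (auto simp: AE_measure_pmf_iff)
  next
    case 4
    have "(\<Sum>j<q. measure_pmf.expectation ?M (\<lambda>x. g (x j))) = (\<Sum>j<q. (\<Sum>v\<in>V. g v) / card V)"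
      by (intro sum.cong refl) (simp only: lessThan_iff exp)
    then show "PROP ?case" by (intro eq_reflection) simp
  qed simp
  have "{x. \<bar>(\<Sum>j<q. g (x j)) / q - (\<Sum>v\<in>V. g v) / card V\<bar> \<ge> \<delta>} =
      {x. \<bar>(\<Sum>j<q. g (x j)) - q * ((\<Sum>v\<in>V. g v) / card V)\<bar> \<ge> q * \<delta>}"
  proof -
    have "\<bar>a / q - b\<bar> \<ge> \<delta> \<longleftrightarrow> \<bar>a - q * b\<bar> \<ge> q * \<delta>" for a b :: real
    proof -
      have "a - q * b = real q * (a / q - b)" using q by (simp add: right_diff_distrib)
      then show ?thesis using q by (simp add: abs_mult)
    qed
    then show ?thesis by simp
  qed
  also have "measure_pmf.prob ?M \<dots> \<le> 2 * exp (- 2 * (q * \<delta>)\<^sup>2 / (\<Sum>j<q. (1 - 0)\<^sup>2))"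
    using Hoeffding_ineq_abs_ge[of "q * \<delta>"] q \<delta> by simp
  also have "- 2 * (q * \<delta>)\<^sup>2 / (\<Sum>j<q. (1 - 0)\<^sup>2) = - 2 * real q * \<delta>\<^sup>2"
    using q by (simp add: power2_eq_square)
  finally show ?thesis .
qed

section \<open>Greedy reassignment from samples\<close>

definition estimate :: "('v \<Rightarrow> 'v \<Rightarrow> 'k \<Rightarrow> 'k \<Rightarrow> real) \<Rightarrow> nat \<Rightarrow> (nat \<Rightarrow> 'v) \<Rightarrow> (nat \<Rightarrow> 'k) \<Rightarrow> 'v \<Rightarrow> 'k \<Rightarrow> real" where
  "estimate C q x \<pi> v k = (\<Sum>j<q. C v (x j) k (\<pi> j)) / q"

definition greedy :: "('v \<Rightarrow> 'v \<Rightarrow> 'k \<Rightarrow> 'k \<Rightarrow> real) \<Rightarrow> 'k set \<Rightarrow> nat \<Rightarrow> (nat \<Rightarrow> 'v) \<Rightarrow> (nat \<Rightarrow> 'k) \<Rightarrow> 'v \<Rightarrow> 'k" where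
  "greedy C K q x \<pi> v = arg_min_on (estimate C q x \<pi> v) K"

text \<open>This is determined by the samples \<open>x\<close> and the guessed types
  \<open>\<pi>\<close>; its value at \<open>v\<close> involves \<open>C\<close> only between
  \<open>v\<close> and the sample of its cell.\<close>

definition candidate :: "('v \<Rightarrow> 'v \<Rightarrow> 'k \<Rightarrow> 'k \<Rightarrow> real) \<Rightarrow> 'k set \<Rightarrow> ('v \<Rightarrow> nat) \<Rightarrow> nat \<Rightarrow>
    (nat \<Rightarrow> nat \<Rightarrow> 'v) \<Rightarrow> (nat \<Rightarrow> nat \<Rightarrow> 'k) \<Rightarrow> 'v \<Rightarrow> 'k" where
  "candidate C K cell q x \<pi> v = greedy C K q (x (cell v)) (\<pi> (cell v)) v"

lemma estimate_cong: "(\<And>j. j < q \<Longrightarrow> \<pi> j = \<pi>' j) \<Longrightarrow> estimate C q x \<pi> = estimate C q x \<pi>'"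
  by (simp add: estimate_def fun_eq_iff)

text \<open>\<open>balanced\<close> limits the pairs inside one cell, whose interaction is out of
  control when a whole cell is reassigned at once.\<close>

locale assignment_cost =
  fixes V :: "'v set" and K :: "'k set" and C :: "'v \<Rightarrow> 'v \<Rightarrow> 'k \<Rightarrow> 'k \<Rightarrow> real"
    and cell :: "'v \<Rightarrow> nat" and q t :: nat
  assumes V: "finite V" "V \<noteq> {}" and K: "finite K" "K \<noteq> {}"
    and C_nonneg: "0 \<le> C u v k l" and C_le_1: "C u v k l \<le> 1"
    and C_commute: "C u v k l = C v u l k" and C_diag: "C u u k l = 0"
    and q_pos: "q > 0" and t_pos: "t > 0" and cell: "v \<in> V \<Longrightarrow> cell v < t"
    and balanced: "t * card {(u, v). u \<in> V \<and> v \<in> V \<and> u \<noteq> v \<and> cell u = cell v} \<le> (card V)\<^sup>2"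
begin

definition cost :: "('v \<Rightarrow> 'k) \<Rightarrow> real" where
  "cost \<sigma> = (\<Sum>u\<in>V. \<Sum>v\<in>V. C u v (\<sigma> u) (\<sigma> v))"

definition local_cost :: "('v \<Rightarrow> 'k) \<Rightarrow> 'v \<Rightarrow> 'k \<Rightarrow> real" where
  "local_cost \<sigma> u k = (\<Sum>v\<in>V. C u v k (\<sigma> v)) / card V"

lemma card_V_pos: "card V > 0" using V by (simp add: card_gt_0_iff)

lemma greedy_in_K: "greedy C K q x \<pi> v \<in> K"
  unfolding greedy_def using K by (rule arg_min_if_finite(1))

lemma greedy_le: "k \<in> K \<Longrightarrow> estimate C q x \<pi> v (greedy C K q x \<pi> v) \<le> estimate C q x \<pi> v k"
  unfolding greedy_def using K by (intro arg_min_least)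

lemma local_cost_bounds: "0 \<le> local_cost \<sigma> u k" "local_cost \<sigma> u k \<le> 1"
proof -
  have "(\<Sum>v\<in>V. C u v k (\<sigma> v)) \<le> (\<Sum>v\<in>V. 1)" by (intro sum_mono C_le_1)
  then show "local_cost \<sigma> u k \<le> 1" using card_V_pos by (simp add: local_cost_def)
qed (simp add: local_cost_def C_nonneg sum_nonneg)

text \<open>Hoeffding's inequality and a union bound over \<open>K\<close> make all estimates
  accurate up to \<open>\<delta>\<close>, and then the greedy type loses at most
  \<open>2 * \<delta>\<close> against \<open>k\<close>. In the exceptional event the loss is at most
  1, as local costs lie between 0 and 1.\<close>

lemma expected_greedy_cost:
  fixes \<delta> :: real
  assumes \<delta>: "\<delta> \<ge> 0" and k: "k \<in> K"
  shows "measure_pmf.expectation (uniform_tuple d q V)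
      (\<lambda>x. local_cost \<sigma> u (greedy C K q x (\<lambda>j. \<sigma> (x j)) u))
    \<le> local_cost \<sigma> u k + (2 * \<delta> + card K * (2 * exp (- 2 * real q * \<delta>\<^sup>2)))"
proof -
  let ?M = "uniform_tuple d q V"
  let ?est = "\<lambda>x. estimate C q x (\<lambda>j. \<sigma> (x j)) u"
  define bad where "bad k = {x. \<bar>?est x k - local_cost \<sigma> u k\<bar> \<ge> \<delta>}" for k
  define B where "B = (\<Union>k\<in>K. bad k)"
  have "measure_pmf.prob ?M B \<le> (\<Sum>k\<in>K. measure_pmf.prob ?M (bad k))"
    unfolding B_def using K by (intro measure_pmf.finite_measure_subadditive_finite) auto
  also have "\<dots> \<le> (\<Sum>k\<in>K. 2 * exp (- 2 * real q * \<delta>\<^sup>2))"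
  proof (rule sum_mono)
    fix k
    show "measure_pmf.prob ?M (bad k) \<le> 2 * exp (- 2 * real q * \<delta>\<^sup>2)"
      unfolding bad_def estimate_def local_cost_def
      by (rule Hoeffding_uniform_tuple[OF V q_pos _ \<delta>]) (simp add: C_nonneg C_le_1)
  qed
  finally have B: "measure_pmf.prob ?M B \<le> card K * (2 * exp (- 2 * real q * \<delta>\<^sup>2))" by simp
  have "local_cost \<sigma> u (greedy C K q x (\<lambda>j. \<sigma> (x j)) u) \<le> local_cost \<sigma> u k + 2 * \<delta> + indicator B x" for x
  proof (cases "x \<in> B")
    case True
    then show ?thesis using local_cost_bounds[of \<sigma> u] \<delta> by (simp add: add_increasing)
  next
    case False
    let ?k = "greedy C K q x (\<lambda>j. \<sigma> (x j)) u"
    have "\<bar>?est x k - local_cost \<sigma> u k\<bar> < \<delta>" "\<bar>?est x ?k - local_cost \<sigma> u ?k\<bar> < \<delta>"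
      using False k greedy_in_K by (auto simp: B_def bad_def not_le)
    moreover have "?est x ?k \<le> ?est x k" using k by (rule greedy_le)
    ultimately show ?thesis using False by (simp add: abs_less_iff)
  qed
  then have "measure_pmf.expectation ?M (\<lambda>x. local_cost \<sigma> u (greedy C K q x (\<lambda>j. \<sigma> (x j)) u))
      \<le> measure_pmf.expectation ?M (\<lambda>x. local_cost \<sigma> u k + 2 * \<delta> + indicator B x)"
    using finite_set_uniform_tuple[OF V] by (intro expectation_mono_finite_pmf) auto
  also have "\<dots> = local_cost \<sigma> u k + 2 * \<delta> + measure_pmf.prob ?M B"
    by (subst Bochner_Integration.integral_add)
      (auto intro!: integrable_measure_pmf_finite finite_set_uniform_tuple V)
  finally show ?thesis using B by simp
qed

definition pairs_in_part :: "nat \<Rightarrow> nat" where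
  "pairs_in_part i = card {(u, v). u \<in> V \<and> v \<in> V \<and> u \<noteq> v \<and> cell u = i \<and> cell v = i}"

text \<open>The change is linear up to the pairs with both ends in cell \<open>i\<close>. For such a
  pair 3 is enough: the new cost is at most 1, the old one is nonnegative, and the two linear terms
  are at least -1 each.\<close>

lemma cost_change:
  assumes eq: "\<And>v. v \<in> V \<Longrightarrow> cell v \<noteq> i \<Longrightarrow> \<sigma>' v = \<sigma> v"
  shows "cost \<sigma>' \<le> cost \<sigma> + 2 * card V * (\<Sum>u\<in>{u \<in> V. cell u = i}. local_cost \<sigma> u (\<sigma>' u) - local_cost \<sigma> u (\<sigma> u))
    + 3 * pairs_in_part i"
proof -
  define a where "a u v = C u v (\<sigma>' u) (\<sigma> v) - C u v (\<sigma> u) (\<sigma> v)" for u v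
  let ?P = "\<lambda>u v. u \<noteq> v \<and> cell u = i \<and> cell v = i"
  have ge: "-1 \<le> a u v" for u v
    using C_nonneg[of u v "\<sigma>' u" "\<sigma> v"] C_le_1[of u v "\<sigma> u" "\<sigma> v"] by (simp add: a_def)
  have "C u v (\<sigma>' u) (\<sigma>' v) \<le> C u v (\<sigma> u) (\<sigma> v) + a u v + a v u + 3 * of_bool (?P u v)"
    if uv: "u \<in> V" "v \<in> V" for u v
  proof (cases "?P u v")
    case True
    have "C u v (\<sigma>' u) (\<sigma>' v) \<le> 1" "0 \<le> C u v (\<sigma> u) (\<sigma> v)" by (rule C_le_1 C_nonneg)+
    then show ?thesis using True ge[of u v] ge[of v u] by simp
  next
    case False
    then consider "u = v" | "cell u \<noteq> i" | "cell v \<noteq> i" by blast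
    then show ?thesis
    proof cases
      case 1
      then show ?thesis by (simp add: C_diag a_def)
    next
      case 2
      then have "\<sigma>' u = \<sigma> u" using eq uv by blast
      then show ?thesis
        using False C_commute[of v u "\<sigma>' v" "\<sigma> u"] C_commute[of v u "\<sigma> v" "\<sigma> u"] by (simp add: a_def)
    next
      case 3
      then have "\<sigma>' v = \<sigma> v" using eq uv by blast
      then show ?thesis using False by (simp add: a_def)
    qed
  qed
  then have "cost \<sigma>' \<le> (\<Sum>u\<in>V. \<Sum>v\<in>V. C u v (\<sigma> u) (\<sigma> v) + a u v + a v u + 3 * of_bool (?P u v))"
    unfolding cost_def by (intro sum_mono) auto
  also have "\<dots> = cost \<sigma> + (\<Sum>u\<in>V. \<Sum>v\<in>V. a u v) + (\<Sum>u\<in>V. \<Sum>v\<in>V. a v u)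
      + 3 * (\<Sum>u\<in>V. \<Sum>v\<in>V. of_bool (?P u v))"
    by (simp add: cost_def sum.distrib sum_distrib_left)
  also have "(\<Sum>u\<in>V. \<Sum>v\<in>V. a v u) = (\<Sum>u\<in>V. \<Sum>v\<in>V. a u v)" by (rule sum.swap)
  also have "(\<Sum>u\<in>V. \<Sum>v\<in>V. a u v) = (\<Sum>u\<in>V. card V * (local_cost \<sigma> u (\<sigma>' u) - local_cost \<sigma> u (\<sigma> u)))"
    using card_V_pos by (intro sum.cong refl) (simp add: a_def local_cost_def sum_subtractf field_simps)
  also have "\<dots> = (\<Sum>u\<in>{u \<in> V. cell u = i}. card V * (local_cost \<sigma> u (\<sigma>' u) - local_cost \<sigma> u (\<sigma> u)))"
    using V eq by (intro sum.mono_neutral_right) auto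
  also have "\<dots> = card V * (\<Sum>u\<in>{u \<in> V. cell u = i}. local_cost \<sigma> u (\<sigma>' u) - local_cost \<sigma> u (\<sigma> u))"
    by (simp add: sum_distrib_left)
  also have "(\<Sum>u\<in>V. \<Sum>v\<in>V. of_bool (?P u v)) = real (pairs_in_part i)"
  proof -
    have "(\<Sum>u\<in>V. \<Sum>v\<in>V. of_bool (?P u v)) = (\<Sum>z\<in>V \<times> V. of_bool (?P (fst z) (snd z)) :: real)"
      by (simp add: sum.cartesian_product case_prod_unfold)
    also have "\<dots> = real (card {z \<in> V \<times> V. ?P (fst z) (snd z)})"
      using V by (simp add: Int_def flip: of_bool_conj)
    also have "{z \<in> V \<times> V. ?P (fst z) (snd z)} = {(u, v). u \<in> V \<and> v \<in> V \<and> u \<noteq> v \<and> cell u = i \<and> cell v = i}"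
      by auto
    finally show ?thesis by (simp add: pairs_in_part_def)
  qed
  finally show ?thesis by simp
qed

text \<open>
  The guess used for the sample \<open>x i\<close> consists of the values of the current hybrid, which does not
  depend on \<open>x i\<close>. So \<open>x i\<close> is a fresh sample when the cells are reassigned one after the other.
\<close>

primrec hybrid :: "('v \<Rightarrow> 'k) \<Rightarrow> (nat \<Rightarrow> nat \<Rightarrow> 'v) \<Rightarrow> nat \<Rightarrow> 'v \<Rightarrow> 'k" where
  "hybrid \<sigma> x 0 = \<sigma>"
| "hybrid \<sigma> x (Suc i) =
     (\<lambda>v. if cell v = i then greedy C K q (x i) (\<lambda>j. hybrid \<sigma> x i (x i j)) v else hybrid \<sigma> x i v)"

lemma hybrid_cong: "(\<And>i'. i' < i \<Longrightarrow> x i' = y i') \<Longrightarrow> hybrid \<sigma> x i = hybrid \<sigma> y i"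
proof (induction i)
  case (Suc i)
  then have "hybrid \<sigma> x i = hybrid \<sigma> y i" "x i = y i" by simp_all
  then show ?case by (simp cong: if_cong)
qed simp

lemma hybrid_in_K: "(\<And>v. v \<in> V \<Longrightarrow> \<sigma> v \<in> K) \<Longrightarrow> v \<in> V \<Longrightarrow> hybrid \<sigma> x i v \<in> K"
  by (induction i) (auto simp: greedy_in_K)

text \<open>Each vertex receives its final type in the round of its own cell.\<close>

lemma hybrid_eq:
  "hybrid \<sigma> x i v = (if cell v < i then
     greedy C K q (x (cell v)) (\<lambda>j. hybrid \<sigma> x (cell v) (x (cell v) j)) v else \<sigma> v)"
  by (induction i) (auto simp: less_Suc_eq)

abbreviation samples :: "'v \<Rightarrow> nat \<Rightarrow> (nat \<Rightarrow> nat \<Rightarrow> 'v) pmf" where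
  "samples d i \<equiv> Pi_pmf {..<i} (\<lambda>_. d) (\<lambda>_. uniform_tuple d q V)"

lemma finite_set_samples: "finite (set_pmf (samples d i))"
  by (subst set_Pi_pmf) (auto intro!: finite_PiE_dflt finite_set_uniform_tuple V)

text \<open>The current type \<open>\<sigma> u\<close> competes in the greedy choice, so each vertex
  of the cell adds in expectation at most the estimation error to the linear term of
  \<open>cost_change\<close>.\<close>

lemma expected_step:
  fixes \<delta> :: real
  assumes \<sigma>: "\<And>v. v \<in> V \<Longrightarrow> \<sigma> v \<in> K" and \<delta>: "\<delta> \<ge> 0"
  shows "measure_pmf.expectation (uniform_tuple d q V)
      (\<lambda>x. cost (\<lambda>v. if cell v = i then greedy C K q x (\<lambda>j. \<sigma> (x j)) v else \<sigma> v))
    \<le> cost \<sigma> + 2 * card V * (card {u \<in> V. cell u = i} * (2 * \<delta> + card K * (2 * exp (- 2 * real q * \<delta>\<^sup>2))))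
       + 3 * pairs_in_part i"
proof -
  let ?M = "uniform_tuple d q V"
  let ?\<beta> = "2 * \<delta> + card K * (2 * exp (- 2 * real q * \<delta>\<^sup>2))"
  let ?A = "{u \<in> V. cell u = i}"
  let ?l = "\<lambda>x u. local_cost \<sigma> u (greedy C K q x (\<lambda>j. \<sigma> (x j)) u)"
  note fin = finite_set_uniform_tuple[OF V]
  note int = integrable_measure_pmf_finite[OF fin]
  have "measure_pmf.expectation ?M (\<lambda>x. cost (\<lambda>v. if cell v = i then greedy C K q x (\<lambda>j. \<sigma> (x j)) v else \<sigma> v))
      \<le> measure_pmf.expectation ?M (\<lambda>x. cost \<sigma> + 2 * card V * (\<Sum>u\<in>?A. ?l x u - local_cost \<sigma> u (\<sigma> u)) + 3 * pairs_in_part i)"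
    (is "?L \<le> _")
  proof (rule expectation_mono_finite_pmf[OF fin])
    fix x
    let ?\<sigma>' = "\<lambda>v. if cell v = i then greedy C K q x (\<lambda>j. \<sigma> (x j)) v else \<sigma> v"
    have "(\<Sum>u\<in>?A. local_cost \<sigma> u (?\<sigma>' u) - local_cost \<sigma> u (\<sigma> u)) = (\<Sum>u\<in>?A. ?l x u - local_cost \<sigma> u (\<sigma> u))"
      by (intro sum.cong) auto
    then show "cost ?\<sigma>' \<le> cost \<sigma> + 2 * card V * (\<Sum>u\<in>?A. ?l x u - local_cost \<sigma> u (\<sigma> u)) + 3 * pairs_in_part i"
      using cost_change[of i ?\<sigma>' \<sigma>] by simp
  qed
  also have "\<dots> = cost \<sigma> + 2 * card V * (\<Sum>u\<in>?A. measure_pmf.expectation ?M (\<lambda>x. ?l x u) - local_cost \<sigma> u (\<sigma> u)) + 3 * pairs_in_part i"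
    by (simp add: Bochner_Integration.integral_add Bochner_Integration.integral_sum
        Bochner_Integration.integral_diff int)
  also have "\<dots> \<le> cost \<sigma> + 2 * card V * (\<Sum>u\<in>?A. ?\<beta>) + 3 * pairs_in_part i"
  proof (intro add_mono mult_left_mono sum_mono)
    fix u assume "u \<in> ?A"
    then have "\<sigma> u \<in> K" using \<sigma> by simp
    from expected_greedy_cost[OF \<delta> this, of d \<sigma> u]
    show "measure_pmf.expectation ?M (\<lambda>x. ?l x u) - local_cost \<sigma> u (\<sigma> u) \<le> ?\<beta>" by simp
  qed simp_all
  finally show ?thesis by simp
qed

lemma expected_hybrid:
  fixes \<delta> :: real
  assumes \<sigma>: "\<And>v. v \<in> V \<Longrightarrow> \<sigma> v \<in> K" and \<delta>: "\<delta> \<ge> 0"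
  shows "measure_pmf.expectation (samples d i) (\<lambda>x. cost (hybrid \<sigma> x i))
    \<le> cost \<sigma> + (\<Sum>i'<i. 2 * card V * (card {u \<in> V. cell u = i'} * (2 * \<delta> + card K * (2 * exp (- 2 * real q * \<delta>\<^sup>2))))
       + 3 * pairs_in_part i')"
proof (induction i)
  case 0
  show ?case by simp
next
  case (Suc i)
  let ?M = "uniform_tuple d q V"
  let ?g = "\<lambda>i'. 2 * card V * (card {u \<in> V. cell u = i'} * (2 * \<delta> + card K * (2 * exp (- 2 * real q * \<delta>\<^sup>2)))) + 3 * pairs_in_part i'"
  note fin = finite_set_uniform_tuple[OF V]
  \<comment> \<open>The sample of round \<open>i\<close> is split off. The hybrid before that round
    does not depend on it, so \<open>expected_step\<close> applies with the earlier samples held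
    fixed.\<close>
  have swap: "samples d (Suc i) = map_pmf (\<lambda>(f, y). f(i := y)) (pair_pmf (samples d i) ?M)"
    unfolding lessThan_Suc
    by (subst Pi_pmf_insert, simp, simp, subst pair_commute_pmf)
      (simp add: pmf.map_comp o_def case_prod_unfold)
  have "measure_pmf.expectation (samples d (Suc i)) (\<lambda>x. cost (hybrid \<sigma> x (Suc i)))
      = measure_pmf.expectation (samples d i) (\<lambda>f. measure_pmf.expectation ?M (\<lambda>y. cost (hybrid \<sigma> (f(i := y)) (Suc i))))"
    unfolding swap integral_map_pmf
    by (subst expectation_pair_finite_pmf[OF finite_set_samples fin]) (simp only: prod.case)
  also have "\<dots> \<le> measure_pmf.expectation (samples d i) (\<lambda>f. cost (hybrid \<sigma> f i) + ?g i)"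
  proof (rule expectation_mono_finite_pmf[OF finite_set_samples])
    fix f
    have eq: "hybrid \<sigma> (f(i := y)) i = hybrid \<sigma> f i" for y by (rule hybrid_cong) simp
    show "measure_pmf.expectation ?M (\<lambda>y. cost (hybrid \<sigma> (f(i := y)) (Suc i))) \<le> cost (hybrid \<sigma> f i) + ?g i"
      using expected_step[of "hybrid \<sigma> f i", OF hybrid_in_K[OF \<sigma>] \<delta>, where d = d and i = i] by (simp add: eq cong: if_cong)
  qed
  also have "\<dots> = measure_pmf.expectation (samples d i) (\<lambda>f. cost (hybrid \<sigma> f i)) + ?g i"
    by (subst Bochner_Integration.integral_add)
      (auto intro!: integrable_measure_pmf_finite finite_set_samples)
  finally show ?case using Suc by simp
qed

abbreviation guesses :: "(nat \<Rightarrow> nat \<Rightarrow> 'k) set" where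
  "guesses \<equiv> {..<t} \<rightarrow>\<^sub>E ({..<q} \<rightarrow>\<^sub>E K)"

text \<open>The process starts at an optimal \<open>\<tau>\<close>, so the increase of the cost is
  nonnegative and Markov's inequality turns the bound on its expectation into one on a
  probability.\<close>

lemma prob_no_good_candidate:
  fixes \<delta> \<gamma> :: real
  assumes \<sigma>: "\<And>v. v \<in> V \<Longrightarrow> \<sigma> v \<in> K" and \<delta>: "\<delta> \<ge> 0" and \<gamma>: "\<gamma> > 0"
  shows "measure_pmf.prob (samples d t)
      {x. \<not> (\<exists>\<pi>\<in>guesses. cost (candidate C K cell q x \<pi>) < cost \<sigma> + \<gamma> * (card V)\<^sup>2)}
    \<le> (2 * (2 * \<delta> + card K * (2 * exp (- 2 * real q * \<delta>\<^sup>2))) + 3 / t) / \<gamma>"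
proof -
  let ?\<beta> = "2 * \<delta> + card K * (2 * exp (- 2 * real q * \<delta>\<^sup>2))"
  let ?n = "real (card V)"
  have npos: "?n > 0" using card_V_pos by simp
  obtain \<tau> where \<tau>: "\<tau> \<in> V \<rightarrow>\<^sub>E K" and opt: "\<And>\<tau>'. \<tau>' \<in> V \<rightarrow>\<^sub>E K \<Longrightarrow> cost \<tau> \<le> cost \<tau>'"
  proof -
    have "finite (V \<rightarrow>\<^sub>E K)" "V \<rightarrow>\<^sub>E K \<noteq> {}" using V K by (auto simp: finite_PiE PiE_eq_empty_iff)
    note fin = this
    show ?thesis
      by (rule that[OF arg_min_if_finite(1)[OF fin, of cost]]) (rule arg_min_least[OF fin])
  qed
  have opt': "cost \<tau> \<le> cost \<tau>'" if "\<And>v. v \<in> V \<Longrightarrow> \<tau>' v \<in> K" for \<tau>'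
  proof -
    have "cost (restrict \<tau>' V) = cost \<tau>'" unfolding cost_def by (intro sum.cong refl) simp
    then show ?thesis using opt[of "restrict \<tau>' V"] that by auto
  qed
  have \<tau>K: "\<And>v. v \<in> V \<Longrightarrow> \<tau> v \<in> K" using \<tau> by auto
  let ?h = "\<lambda>x. cost (hybrid \<tau> x t) - cost \<tau>"
  have sum_parts: "(\<Sum>i<t. card {u \<in> V. cell u = i}) = card V"
  proof -
    have "(\<Sum>i<t. card {u \<in> V. cell u = i}) = card (\<Union>i<t. {u \<in> V. cell u = i})"
      using V by (subst card_UN_disjoint) auto
    also have "(\<Union>i<t. {u \<in> V. cell u = i}) = V" using cell by auto
    finally show ?thesis .
  qed
  have sum_pairs: "real (\<Sum>i<t. pairs_in_part i) \<le> ?n\<^sup>2 / t"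
  proof -
    have "(\<Sum>i<t. pairs_in_part i) = card (\<Union>i<t. {(u, v). u \<in> V \<and> v \<in> V \<and> u \<noteq> v \<and> cell u = i \<and> cell v = i})"
      unfolding pairs_in_part_def
      by (subst card_UN_disjoint) (auto intro: finite_subset[of _ "V \<times> V"] simp: V)
    also have "(\<Union>i<t. {(u, v). u \<in> V \<and> v \<in> V \<and> u \<noteq> v \<and> cell u = i \<and> cell v = i})
        = {(u, v). u \<in> V \<and> v \<in> V \<and> u \<noteq> v \<and> cell u = cell v}" using cell by auto
    finally have "t * (\<Sum>i<t. pairs_in_part i) \<le> (card V)\<^sup>2" using balanced by simp
    then have "real t * real (\<Sum>i<t. pairs_in_part i) \<le> ?n\<^sup>2" by (metis of_nat_le_iff of_nat_mult of_nat_power)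
    then show ?thesis using t_pos by (simp add: field_simps)
  qed
  have "measure_pmf.expectation (samples d t) ?h = measure_pmf.expectation (samples d t) (\<lambda>x. cost (hybrid \<tau> x t)) - cost \<tau>"
    by (subst Bochner_Integration.integral_diff)
      (auto intro!: integrable_measure_pmf_finite finite_set_samples)
  also have "\<dots> \<le> (\<Sum>i<t. 2 * card V * (card {u \<in> V. cell u = i} * ?\<beta>) + 3 * pairs_in_part i)"
    using expected_hybrid[where \<sigma> = \<tau> and d = d and i = t, OF \<tau>K \<delta>] by simp
  also have "\<dots> = 2 * ?n * ((\<Sum>i<t. card {u \<in> V. cell u = i}) * ?\<beta>) + 3 * real (\<Sum>i<t. pairs_in_part i)"
    by (simp only: sum.distrib of_nat_sum of_nat_mult of_nat_numeral sum_distrib_left sum_distrib_right)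
  also have "\<dots> \<le> 2 * ?n * (?n * ?\<beta>) + 3 * (?n\<^sup>2 / t)" unfolding sum_parts using sum_pairs by simp
  also have "\<dots> = (2 * ?\<beta> + 3 / t) * ?n\<^sup>2" by (simp add: power2_eq_square field_simps)
  finally have E: "measure_pmf.expectation (samples d t) ?h \<le> (2 * ?\<beta> + 3 / t) * ?n\<^sup>2" .
  have "measure_pmf.prob (samples d t)
      {x. \<not> (\<exists>\<pi>\<in>guesses. cost (candidate C K cell q x \<pi>) < cost \<sigma> + \<gamma> * (card V)\<^sup>2)}
    \<le> measure_pmf.prob (samples d t) {x. ?h x \<ge> \<gamma> * ?n\<^sup>2}"
  proof (rule measure_pmf.finite_measure_mono_AE)
    show "AE x in measure_pmf (samples d t).
      x \<in> {x. \<not> (\<exists>\<pi>\<in>guesses. cost (candidate C K cell q x \<pi>) < cost \<sigma> + \<gamma> * (card V)\<^sup>2)} \<longrightarrow>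
      x \<in> {x. ?h x \<ge> \<gamma> * ?n\<^sup>2}"
    proof (rule AE_pmfI, rule impI, rule ccontr)
      fix x assume x: "x \<in> set_pmf (samples d t)"
        and no: "x \<in> {x. \<not> (\<exists>\<pi>\<in>guesses. cost (candidate C K cell q x \<pi>) < cost \<sigma> + \<gamma> * (card V)\<^sup>2)}"
        and small: "x \<notin> {x. ?h x \<ge> \<gamma> * ?n\<^sup>2}"
      have xV: "x i j \<in> V" if "i < t" "j < q" for i j
        using x that V by (auto simp: set_Pi_pmf PiE_dflt_def)
      \<comment> \<open>The correct guess consists of the types that the successive hybrids give to
        the samples. With it the candidate agrees with the final hybrid on \<open>V\<close>.\<close>
      define \<pi> where "\<pi> = (\<lambda>i\<in>{..<t}. \<lambda>j\<in>{..<q}. hybrid \<tau> x i (x i j))"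
      have "\<pi> \<in> guesses" using xV hybrid_in_K[OF \<tau>K] by (auto simp: \<pi>_def)
      moreover have "cost (candidate C K cell q x \<pi>) = cost (hybrid \<tau> x t)"
      proof -
        have "candidate C K cell q x \<pi> v = hybrid \<tau> x t v" if "v \<in> V" for v
        proof -
          have "estimate C q (x (cell v)) (\<pi> (cell v)) = estimate C q (x (cell v)) (\<lambda>j. hybrid \<tau> x (cell v) (x (cell v) j))"
            using cell[OF that] by (intro estimate_cong) (simp add: \<pi>_def)
          then show ?thesis using cell[OF that] by (simp add: candidate_def greedy_def hybrid_eq[of _ _ t])
        qed
        then show ?thesis unfolding cost_def by (intro sum.cong refl) simp
      qed
      moreover have "cost \<tau> \<le> cost \<sigma>" using opt' \<sigma> by blast
      ultimately show False using no small by (auto simp: not_le not_less)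
    qed
  qed simp
  also have "\<dots> \<le> measure_pmf.expectation (samples d t) ?h / (\<gamma> * ?n\<^sup>2)"
  proof (rule prob_Markov_finite_pmf[OF finite_set_samples])
    show "0 \<le> ?h x" for x using opt'[OF hybrid_in_K[OF \<tau>K]] by simp
    show "0 < \<gamma> * ?n\<^sup>2" using \<gamma> npos by simp
  qed
  also have "\<dots> \<le> (2 * ?\<beta> + 3 / t) * ?n\<^sup>2 / (\<gamma> * ?n\<^sup>2)" using E \<gamma> by (intro divide_right_mono) auto
  also have "\<dots> = (2 * ?\<beta> + 3 / t) / \<gamma>" using npos by simp
  finally show ?thesis .
qed

end

section \<open>Selecting a hypothesis by its empirical cost\<close>

definition empirical :: "('v \<Rightarrow> 'v \<Rightarrow> 'k \<Rightarrow> 'k \<Rightarrow> real) \<Rightarrow> nat \<Rightarrow> (nat \<Rightarrow> 'v \<times> 'v) \<Rightarrow> ('v \<Rightarrow> 'k) \<Rightarrow> real" where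
  "empirical C r w \<sigma> = (\<Sum>l<r. C (fst (w l)) (snd (w l)) (\<sigma> (fst (w l))) (\<sigma> (snd (w l)))) / r"

text \<open>A parameter \<open>\<theta>\<close>, later a parent map, fixes the set of types; it is
  combined with guessed types for all samples.\<close>

definition hypotheses :: "'p set \<Rightarrow> ('p \<Rightarrow> 'k set) \<Rightarrow> nat \<Rightarrow> nat \<Rightarrow> ('p \<times> (nat \<Rightarrow> nat \<Rightarrow> 'k)) set" where
  "hypotheses \<Theta> K q t = Sigma \<Theta> (\<lambda>\<theta>. {..<t} \<rightarrow>\<^sub>E ({..<q} \<rightarrow>\<^sub>E K \<theta>))"

definition min_empirical :: "'p set \<Rightarrow> ('p \<Rightarrow> 'k set) \<Rightarrow> ('v \<Rightarrow> 'v \<Rightarrow> 'k \<Rightarrow> 'k \<Rightarrow> real) \<Rightarrow> ('v \<Rightarrow> nat) \<Rightarrow>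
    nat \<Rightarrow> nat \<Rightarrow> nat \<Rightarrow> (nat \<Rightarrow> nat \<Rightarrow> 'v) \<Rightarrow> (nat \<Rightarrow> 'v \<times> 'v) \<Rightarrow> real" where
  "min_empirical \<Theta> K C cell q t r x w =
     Min ((\<lambda>(\<theta>, \<pi>). empirical C r w (candidate C (K \<theta>) cell q x \<pi>)) ` hypotheses \<Theta> K q t)"

locale assignment_family =
  fixes V :: "'v set" and \<Theta> :: "'p set" and K :: "'p \<Rightarrow> 'k set" and C :: "'v \<Rightarrow> 'v \<Rightarrow> 'k \<Rightarrow> 'k \<Rightarrow> real"
    and cell :: "'v \<Rightarrow> nat" and q t r c :: nat
  assumes family: "\<theta> \<in> \<Theta> \<Longrightarrow> assignment_cost V (K \<theta>) C cell q t"
    and \<Theta>: "finite \<Theta>" "\<Theta> \<noteq> {}" and card_K: "\<theta> \<in> \<Theta> \<Longrightarrow> card (K \<theta>) \<le> c" and r_pos: "r > 0"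
begin

abbreviation "hyps \<equiv> hypotheses \<Theta> K q t"

abbreviation "min_emp \<equiv> min_empirical \<Theta> K C cell q t r"

definition total_cost :: "('v \<Rightarrow> 'k) \<Rightarrow> real" where
  "total_cost \<sigma> = (\<Sum>u\<in>V. \<Sum>v\<in>V. C u v (\<sigma> u) (\<sigma> v))"

lemma hypotheses: "finite hyps" "hyps \<noteq> {}" "card hyps \<le> card \<Theta> * c ^ (q * t)"
proof -
  have K: "finite (K \<theta>)" "K \<theta> \<noteq> {}" if "\<theta> \<in> \<Theta>" for \<theta>
    using family[OF that] by (auto simp: assignment_cost_def)
  have fin: "finite ({..<t} \<rightarrow>\<^sub>E ({..<q} \<rightarrow>\<^sub>E K \<theta>))" if "\<theta> \<in> \<Theta>" for \<theta>
    using K[OF that] by (intro finite_PiE) auto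
  show "finite hyps" unfolding hypotheses_def using \<Theta> fin by auto
  obtain \<theta> where \<theta>: "\<theta> \<in> \<Theta>" using \<Theta> by blast
  have "{..<t} \<rightarrow>\<^sub>E ({..<q} \<rightarrow>\<^sub>E K \<theta>) \<noteq> {}" using K[OF \<theta>] by (simp add: PiE_eq_empty_iff)
  then show "hyps \<noteq> {}" unfolding hypotheses_def using \<theta> by blast
  have "card hyps = (\<Sum>\<theta>\<in>\<Theta>. card (K \<theta>) ^ (q * t))"
    unfolding hypotheses_def using \<Theta> fin by (simp add: card_PiE power_mult)
  also have "\<dots> \<le> (\<Sum>\<theta>\<in>\<Theta>. c ^ (q * t))" using card_K by (intro sum_mono power_mono) auto
  finally show "card hyps \<le> card \<Theta> * c ^ (q * t)" by simp
qed

text \<open>Two events of probability at most 1/6 are excluded: no guess for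
  \<open>\<theta>0\<close> gives a good candidate, or the empirical cost of some hypothesis is off
  by at least \<open>\<eta>\<close>. Once \<open>x\<close> is fixed the candidates are fixed, and
  the independent pairs \<open>w\<close> permit a union bound over them. The minimum is then
  attained by a genuine assignment, whence the lower bound, and is at most the value of the good
  candidate.\<close>

lemma min_empirical_approx:
  fixes \<delta> \<gamma> \<eta> :: real
  assumes \<theta>0: "\<theta>0 \<in> \<Theta>" and \<sigma>: "\<And>v. v \<in> V \<Longrightarrow> \<sigma> v \<in> K \<theta>0"
    and pos: "\<delta> \<ge> 0" "\<gamma> > 0" "\<eta> > 0"
    and small1: "(2 * (2 * \<delta> + c * (2 * exp (- 2 * real q * \<delta>\<^sup>2))) + 3 / t) / \<gamma> \<le> 1 / 6"
    and small2: "card \<Theta> * c ^ (q * t) * (2 * exp (- 2 * real r * \<eta>\<^sup>2)) \<le> 1 / 6"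
  shows "2 / 3 \<le> measure_pmf.prob
      (pair_pmf (Pi_pmf {..<t} (\<lambda>_. d) (\<lambda>_. uniform_tuple d q V)) (uniform_tuple d' r (V \<times> V)))
      {(x, w). (\<exists>\<theta>\<in>\<Theta>. \<exists>\<tau>. (\<forall>v. \<tau> v \<in> K \<theta>) \<and> total_cost \<tau> / (card V)\<^sup>2 - \<eta> < min_emp x w) \<and>
         min_emp x w < total_cost \<sigma> / (card V)\<^sup>2 + \<gamma> + \<eta>}"
proof -
  interpret A: assignment_cost V "K \<theta>0" C cell q t by (rule family[OF \<theta>0])
  let ?n2 = "real ((card V)\<^sup>2)"
  have n2: "?n2 > 0" using A.card_V_pos by simp
  let ?p = "Pi_pmf {..<t} (\<lambda>_. d) (\<lambda>_. uniform_tuple d q V)" and ?q = "uniform_tuple d' r (V \<times> V)"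
  let ?M = "pair_pmf ?p ?q"
  let ?cand = "\<lambda>x h. candidate C (K (fst h)) cell q x (snd h)"
  define bad1 where "bad1 = {x. \<not> (\<exists>\<pi>\<in>A.guesses. A.cost (candidate C (K \<theta>0) cell q x \<pi>) < A.cost \<sigma> + \<gamma> * (card V)\<^sup>2)}"
  define bad2 where "bad2 x = (\<Union>h\<in>hyps. {w. \<bar>empirical C r w (?cand x h) - total_cost (?cand x h) / ?n2\<bar> \<ge> \<eta>})" for x
  have cost_eq: "A.cost = total_cost" by (simp add: fun_eq_iff A.cost_def total_cost_def)
  have VV: "finite (V \<times> V)" "V \<times> V \<noteq> {}" using A.V by auto
  have fin: "finite (set_pmf ?p)" "finite (set_pmf ?q)"
    using A.finite_set_samples finite_set_uniform_tuple[OF VV] by auto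
  have "measure_pmf.prob ?p bad1 \<le> (2 * (2 * \<delta> + card (K \<theta>0) * (2 * exp (- 2 * real q * \<delta>\<^sup>2))) + 3 / t) / \<gamma>"
    unfolding bad1_def by (rule A.prob_no_good_candidate[OF \<sigma> pos(1,2)])
  also have "\<dots> \<le> (2 * (2 * \<delta> + c * (2 * exp (- 2 * real q * \<delta>\<^sup>2))) + 3 / t) / \<gamma>"
    using pos card_K[OF \<theta>0] by (intro divide_right_mono add_mono mult_left_mono mult_right_mono) auto
  finally have b1: "measure_pmf.prob ?p bad1 \<le> 1 / 6" using small1 by linarith
  have "measure_pmf.prob ?M {(x, w). x \<in> bad1} = measure_pmf.prob (map_pmf fst ?M) bad1"
    unfolding measure_map_pmf by (intro arg_cong[where f = "measure_pmf.prob ?M"]) auto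
  then have B1: "measure_pmf.prob ?M {(x, w). x \<in> bad1} \<le> 1 / 6" using b1 by (simp add: map_fst_pair_pmf)
  have single: "measure_pmf.prob ?q {w. \<bar>empirical C r w \<tau> - total_cost \<tau> / ?n2\<bar> \<ge> \<eta>} \<le> 2 * exp (- 2 * real r * \<eta>\<^sup>2)" for \<tau>
  proof -
    let ?g = "\<lambda>z. C (fst z) (snd z) (\<tau> (fst z)) (\<tau> (snd z))"
    have "(\<Sum>z\<in>V \<times> V. ?g z) / card (V \<times> V) = total_cost \<tau> / ?n2"
      by (simp add: total_cost_def sum.cartesian_product case_prod_unfold card_cartesian_product power2_eq_square)
    then show ?thesis
      using Hoeffding_uniform_tuple[OF VV r_pos, of ?g \<eta> d'] A.C_nonneg A.C_le_1 pos
      by (simp add: empirical_def)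
  qed
  have b2: "measure_pmf.prob ?q (bad2 x) \<le> 1 / 6" for x
  proof -
    have "measure_pmf.prob ?q (bad2 x) \<le> (\<Sum>h\<in>hyps. measure_pmf.prob ?q
        {w. \<bar>empirical C r w (?cand x h) - total_cost (?cand x h) / ?n2\<bar> \<ge> \<eta>})"
      unfolding bad2_def using hypotheses(1) by (intro measure_pmf.finite_measure_subadditive_finite) auto
    also have "\<dots> \<le> (\<Sum>h\<in>hyps. 2 * exp (- 2 * real r * \<eta>\<^sup>2))" by (intro sum_mono single)
    also have "\<dots> = real (card hyps) * (2 * exp (- 2 * real r * \<eta>\<^sup>2))" by simp
    also have "\<dots> \<le> real (card \<Theta> * c ^ (q * t)) * (2 * exp (- 2 * real r * \<eta>\<^sup>2))"
      using hypotheses(3) by (intro mult_right_mono) (simp_all only: of_nat_le_iff, simp)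
    finally show ?thesis using small2 by simp
  qed
  have B2: "measure_pmf.prob ?M {(x, w). w \<in> bad2 x} \<le> 1 / 6"
    by (rule prob_pair_pmf_le[OF fin b2])
  let ?bad = "{(x, w). x \<in> bad1} \<union> {(x, w). w \<in> bad2 x}"
  let ?good = "{(x, w). (\<exists>\<theta>\<in>\<Theta>. \<exists>\<tau>. (\<forall>v. \<tau> v \<in> K \<theta>) \<and> total_cost \<tau> / (card V)\<^sup>2 - \<eta> < min_emp x w) \<and>
         min_emp x w < total_cost \<sigma> / (card V)\<^sup>2 + \<gamma> + \<eta>}"
  have good: "(\<exists>\<theta>\<in>\<Theta>. \<exists>\<tau>. (\<forall>v. \<tau> v \<in> K \<theta>) \<and> total_cost \<tau> / ?n2 - \<eta> < min_emp x w) \<and>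
      min_emp x w < total_cost \<sigma> / ?n2 + \<gamma> + \<eta>" if nb: "x \<notin> bad1" "w \<notin> bad2 x" for x w
  proof
    let ?f = "\<lambda>(\<theta>, \<pi>). empirical C r w (candidate C (K \<theta>) cell q x \<pi>)"
    have close: "\<bar>?f h - total_cost (?cand x h) / ?n2\<bar> < \<eta>" if "h \<in> hyps" for h
      using nb that by (auto simp: bad2_def case_prod_unfold not_le)
    have "min_emp x w \<in> ?f ` hyps"
      unfolding min_empirical_def using hypotheses by (intro Min_in) auto
    then obtain \<theta> \<pi> where h: "(\<theta>, \<pi>) \<in> hyps" "min_emp x w = ?f (\<theta>, \<pi>)" by auto
    have \<theta>: "\<theta> \<in> \<Theta>" using h by (simp add: hypotheses_def)
    interpret B: assignment_cost V "K \<theta>" C cell q t by (rule family[OF \<theta>])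
    have "candidate C (K \<theta>) cell q x \<pi> v \<in> K \<theta>" for v
      by (simp add: candidate_def B.greedy_in_K)
    moreover have "total_cost (candidate C (K \<theta>) cell q x \<pi>) / ?n2 - \<eta> < min_emp x w"
      using close[OF h(1)] h(2) by (simp add: abs_less_iff)
    ultimately show "\<exists>\<theta>\<in>\<Theta>. \<exists>\<tau>. (\<forall>v. \<tau> v \<in> K \<theta>) \<and> total_cost \<tau> / (card V)\<^sup>2 - \<eta> < min_emp x w"
      using \<theta> by blast
    obtain \<pi>' where \<pi>': "\<pi>' \<in> A.guesses" "total_cost (candidate C (K \<theta>0) cell q x \<pi>') < total_cost \<sigma> + \<gamma> * ?n2"
      using nb by (auto simp: bad1_def cost_eq)
    then have h0: "(\<theta>0, \<pi>') \<in> hyps" using \<theta>0 by (simp add: hypotheses_def)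
    have "min_emp x w \<le> ?f (\<theta>0, \<pi>')"
      unfolding min_empirical_def using hypotheses(1) h0 by (intro Min_le) auto
    also have "\<dots> < total_cost (candidate C (K \<theta>0) cell q x \<pi>') / ?n2 + \<eta>"
      using close[OF h0] by (simp add: abs_less_iff)
    also have "\<dots> < (total_cost \<sigma> + \<gamma> * ?n2) / ?n2 + \<eta>"
      using divide_strict_right_mono[OF \<pi>'(2) n2] by simp
    also have "\<dots> = total_cost \<sigma> / ?n2 + \<gamma> + \<eta>" using n2 by (simp add: add_divide_distrib)
    finally show "min_emp x w < total_cost \<sigma> / (card V)\<^sup>2 + \<gamma> + \<eta>" .
  qed
  have "- ?bad \<subseteq> ?good" using good by auto
  then have "measure_pmf.prob ?M (- ?bad) \<le> measure_pmf.prob ?M ?good"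
    by (intro measure_pmf.finite_measure_mono) auto
  moreover have "measure_pmf.prob ?M (- ?bad) = 1 - measure_pmf.prob ?M ?bad"
    using measure_pmf.prob_compl[of ?bad ?M] by (simp add: Compl_eq_Diff_UNIV)
  moreover have "measure_pmf.prob ?M ?bad \<le> 1 / 6 + 1 / 6"
    using measure_Un_le[of "{(x, w). x \<in> bad1}" ?M "{(x, w). w \<in> bad2 x}"] B1 B2 by simp
  ultimately show ?thesis by linarith
qed

end

text \<open>Members of one residue class are told apart by \<open>v div t\<close>, which takes at
  most \<open>(n - 1) div t + 1\<close> values. Leaving out \<open>u\<close> itself absorbs the
  extra one.\<close>

lemma card_same_residue:
  fixes n t :: nat
  assumes "t > 0"
  shows "t * card {(u, v). u \<in> {..<n} \<and> v \<in> {..<n} \<and> u \<noteq> v \<and> u mod t = v mod t} \<le> (card {..<n})\<^sup>2"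
proof -
  define A where "A u = {v. v < n \<and> u \<noteq> v \<and> u mod t = v mod t}" for u
  have A: "t * card (A u) \<le> n" if "u < n" for u
  proof -
    have inj: "inj_on (\<lambda>v. v div t) (insert u (A u))"
    proof (rule inj_onI)
      fix v w assume vw: "v \<in> insert u (A u)" "w \<in> insert u (A u)" "v div t = w div t"
      then have "v mod t = w mod t" by (auto simp: A_def)
      then show "v = w" using vw(3) by (metis div_mult_mod_eq)
    qed
    have "finite (A u)" by (simp add: A_def)
    have "(\<lambda>v. v div t) ` insert u (A u) \<subseteq> {..(n - 1) div t}"
      using that by (auto simp: A_def intro!: div_le_mono)
    then have "card (insert u (A u)) \<le> card {..(n - 1) div t}"
      using inj by (metis card_image card_mono finite_atMost)
    then have "card (A u) \<le> (n - 1) div t" using \<open>finite (A u)\<close> by (simp add: A_def)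
    then have "t * card (A u) \<le> t * ((n - 1) div t)" by simp
    also have "\<dots> \<le> n" using times_div_less_eq_dividend[of t "n - 1"] by linarith
    finally show ?thesis .
  qed
  have "{(u, v). u \<in> {..<n} \<and> v \<in> {..<n} \<and> u \<noteq> v \<and> u mod t = v mod t} = Sigma {..<n} A"
    by (auto simp: A_def)
  then have "t * card {(u, v). u \<in> {..<n} \<and> v \<in> {..<n} \<and> u \<noteq> v \<and> u mod t = v mod t} = (\<Sum>u<n. t * card (A u))"
    by (simp add: A_def sum_distrib_left)
  also have "\<dots> \<le> (\<Sum>u<n. n)" using A by (intro sum_mono) auto
  finally show ?thesis by (simp add: power2_eq_square)
qed

text \<open>
  The argument \<open>a\<close> records the answers received so far.
\<close>

primrec ask :: "(nat \<times> nat) list \<Rightarrow> ((nat \<Rightarrow> nat \<Rightarrow> bool) \<Rightarrow> real) \<Rightarrow> (nat \<Rightarrow> nat \<Rightarrow> bool) \<Rightarrow> decision_tree" where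
  "ask [] h a = Output (h a)"
| "ask (e # es) h a = Query (fst e) (snd e) (\<lambda>b. ask es h (\<lambda>u v. if (u, v) = e then b else a u v))"

lemma run_ask: "run adj (ask es h a) = h (\<lambda>u v. if (u, v) \<in> set es then adj u v else a u v)"
proof (induction es arbitrary: a)
  case (Cons e es)
  have "(\<lambda>u v. if (u, v) \<in> set es then adj u v else if (u, v) = e then adj (fst e) (snd e) else a u v)
      = (\<lambda>u v. if (u, v) \<in> set (e # es) then adj u v else a u v)"
    by (auto simp: fun_eq_iff)
  then show ?case using Cons by simp
qed simp

lemma num_queries_ask: "num_queries adj (ask es h a) = length es"
  by (induction es arbitrary: a) auto

section \<open>Polynomial bounds\<close>

definition poly_bounded :: "(nat \<Rightarrow> nat) \<Rightarrow> bool" where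
  "poly_bounded f \<longleftrightarrow> (\<exists>c d. \<forall>N\<ge>1. f N \<le> c * N ^ d)"

lemma poly_bounded_const [intro]: "poly_bounded (\<lambda>_. k)"
  unfolding poly_bounded_def by (rule exI[of _ k], rule exI[of _ 0]) simp

lemma poly_bounded_id [intro]: "poly_bounded (\<lambda>N. N)"
  unfolding poly_bounded_def by (rule exI[of _ 1], rule exI[of _ 1]) simp

lemma poly_bounded_add [intro]:
  assumes "poly_bounded f" "poly_bounded g"
  shows "poly_bounded (\<lambda>N. f N + g N)"
proof -
  obtain c d c' d' where f: "\<And>N. N \<ge> 1 \<Longrightarrow> f N \<le> c * N ^ d" and g: "\<And>N. N \<ge> 1 \<Longrightarrow> g N \<le> c' * N ^ d'"
    using assms unfolding poly_bounded_def by blast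
  have "f N + g N \<le> (c + c') * N ^ (d + d')" if N: "N \<ge> 1" for N
  proof -
    have "c * N ^ d \<le> c * N ^ (d + d')" "c' * N ^ d' \<le> c' * N ^ (d + d')"
      using N by (intro mult_le_mono2 power_increasing; simp)+
    then show ?thesis using f[OF N] g[OF N] unfolding distrib_right by linarith
  qed
  then show ?thesis unfolding poly_bounded_def by blast
qed

lemma poly_bounded_mult [intro]:
  assumes "poly_bounded f" "poly_bounded g"
  shows "poly_bounded (\<lambda>N. f N * g N)"
proof -
  obtain c d c' d' where f: "\<And>N. N \<ge> 1 \<Longrightarrow> f N \<le> c * N ^ d" and g: "\<And>N. N \<ge> 1 \<Longrightarrow> g N \<le> c' * N ^ d'"
    using assms unfolding poly_bounded_def by blast
  have "f N * g N \<le> (c * c') * N ^ (d + d')" if N: "N \<ge> 1" for N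
    using mult_le_mono[OF f[OF N] g[OF N]] by (simp add: power_add mult_ac)
  then show ?thesis unfolding poly_bounded_def by blast
qed

section \<open>The distance estimator\<close>

definition edge_cost :: "(nat \<Rightarrow> nat \<Rightarrow> bool) \<Rightarrow> nat \<Rightarrow> nat \<Rightarrow> nat set + nat \<Rightarrow> nat set + nat \<Rightarrow> real" where
  "edge_cost a u v k l = of_bool (u \<noteq> v \<and> conflict k l (a u v))"

lemma finite_types: "finite (types m p)" and types_nonempty: "types m p \<noteq> {}"
  by (auto simp: types_def subtree_def)

lemma card_types: "card (types m p) \<le> 2 ^ (m + 1)"
proof -
  have "card (types m p) \<le> card (Inl ` Pow {..<m} \<union> Inr ` {..<m} :: (nat set + nat) set)"
    by (intro card_mono) (auto simp: types_def)
  also have "\<dots> \<le> card (Inl ` Pow {..<m} :: (nat set + nat) set) + card (Inr ` {..<m} :: (nat set + nat) set)"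
    by (rule card_Un_le)
  also have "\<dots> = 2 ^ m + m" by (simp add: card_image card_Pow)
  also have "\<dots> \<le> 2 ^ (m + 1)" using less_exp[of m] by simp
  finally show ?thesis .
qed

text \<open>\<open>8 * N\<close> replaces \<open>N\<close> in the bound of \<open>card_skel\<close>,
  so that compression costs at most \<open>2 / (8 * N)\<close>.\<close>

definition skel_size :: "nat \<Rightarrow> nat" where "skel_size N = 8 * N * (8 * N + 1)\<^sup>2"

text \<open>The factor makes the term \<open>3 / t\<close>, due to the pairs inside cells, equal to
  \<open>1 / (12 * N)\<close>.\<close>

definition num_parts :: "nat \<Rightarrow> nat" where "num_parts N = 36 * N"

text \<open>\<open>4608\<close> is \<open>96\<^sup>2 / 2\<close>, so with
  \<open>\<delta> = 1 / (96 * N)\<close> the Hoeffding exponent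
  \<open>2 * q * \<delta>\<^sup>2\<close> is \<open>96 * N + m + 1\<close>, where \<open>m\<close>
  is \<open>skel_size N\<close>.\<close>

definition part_sample :: "nat \<Rightarrow> nat" where
  "part_sample N = 4608 * N\<^sup>2 * (96 * N + skel_size N + 1)"

text \<open>With \<open>\<eta> = 1 / (2 * N)\<close> the Hoeffding exponent is the bracket, whose
  summands pay for the parent maps, the guesses and a constant factor 12 in turn.\<close>

definition pair_sample :: "nat \<Rightarrow> nat" where
  "pair_sample N = 2 * N\<^sup>2 * ((skel_size N)\<^sup>2 + (skel_size N + 1) * (part_sample N * num_parts N) + 12)"

text \<open>Halved because the cost counts ordered pairs.\<close>

definition estimator ::
  "nat \<Rightarrow> (nat \<Rightarrow> nat \<Rightarrow> nat) \<Rightarrow> (nat \<Rightarrow> nat \<times> nat) \<Rightarrow> (nat \<Rightarrow> nat \<Rightarrow> bool) \<Rightarrow> real" where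
  "estimator N x w a =
     min_empirical ({..<skel_size N} \<rightarrow>\<^sub>E {..<skel_size N}) (types (skel_size N)) (edge_cost a)
       (\<lambda>v. v mod num_parts N) (part_sample N) (num_parts N) (pair_sample N) x w / 2"

definition samples_pmf :: "nat \<Rightarrow> nat \<Rightarrow> ((nat \<Rightarrow> nat \<Rightarrow> nat) \<times> (nat \<Rightarrow> nat \<times> nat)) pmf" where
  "samples_pmf N n = pair_pmf
     (Pi_pmf {..<num_parts N} (\<lambda>_. 0) (\<lambda>_. uniform_tuple 0 (part_sample N) {..<n}))
     (uniform_tuple (0, 0) (pair_sample N) ({..<n} \<times> {..<n}))"

text \<open>The summand \<open>m + 1\<close> of the exponent outweighs the factor
  \<open>2 ^ (m + 1)\<close>, and \<open>96 * N\<close> leaves an error of at most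
  \<open>1 / (48 * N)\<close>; the first term is the same amount.\<close>

lemma part_sample_bound:
  assumes "N \<ge> 1"
  shows "2 * (1 / (96 * N)) + 2 ^ (skel_size N + 1) * (2 * exp (- 2 * real (part_sample N) * (1 / (96 * N))\<^sup>2)) \<le> 1 / (24 * real N)"
proof -
  let ?m = "skel_size N"
  have N: "real N > 0" using assms by simp
  have e: "2 * real (part_sample N) * (1 / (96 * N))\<^sup>2 = 96 * N + (?m + 1)"
    using N by (simp add: part_sample_def power2_eq_square field_simps)
  have "exp (1::real) \<ge> 2" using exp_ge_add_one_self[of 1] by simp
  then have "exp 1 ^ (?m + 1) \<ge> (2::real) ^ (?m + 1)" by (intro power_mono) auto
  then have p: "exp (real (?m + 1)) \<ge> 2 ^ (?m + 1)" by (simp only: exp_of_nat_mult[symmetric] mult_1_right)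
  have "exp (96 * real N) \<ge> 96 * real N" using exp_ge_add_one_self[of "96 * real N"] by linarith
  then have "(96 * real N) * 2 ^ (?m + 1) \<le> exp (96 * real N) * exp (real (?m + 1))"
    using p N by (intro mult_mono) auto
  also have "\<dots> = exp (2 * real (part_sample N) * (1 / (96 * N))\<^sup>2)"
    unfolding e by (simp add: exp_add[symmetric])
  finally have "(96 * real N) * 2 ^ (?m + 1) * exp (- (2 * real (part_sample N) * (1 / (96 * N))\<^sup>2)) \<le> 1"
    by (simp add: exp_minus field_simps)
  then have "2 ^ (?m + 1) * (2 * exp (- 2 * real (part_sample N) * (1 / (96 * N))\<^sup>2)) \<le> 1 / (48 * real N)"
    using N by (simp add: field_simps)
  then show ?thesis using N by (simp add: field_simps)
qed

lemma pair_sample_bound: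
  fixes N :: nat
  defines "m \<equiv> skel_size N"
  assumes "N \<ge> 1"
  shows "real (card ({..<m} \<rightarrow>\<^sub>E {..<m}) * (2 ^ (m + 1)) ^ (part_sample N * num_parts N))
    * (2 * exp (- 2 * real (pair_sample N) * (1 / (2 * N))\<^sup>2)) \<le> 1 / 6"
proof -
  let ?s = "part_sample N * num_parts N"
  have N: "real N > 0" using assms by simp
  have e: "2 * real (pair_sample N) * (1 / (2 * N))\<^sup>2 = real (m * m) + real ((m + 1) * ?s) + 12"
    using N by (simp add: pair_sample_def m_def power2_eq_square field_simps)
  have "real m \<le> exp (real m)" using exp_ge_add_one_self[of "real m"] by linarith
  then have "real m ^ m \<le> exp (real m) ^ m" by (intro power_mono) auto
  then have 1: "real (card ({..<m} \<rightarrow>\<^sub>E {..<m})) \<le> exp (real (m * m))"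
    by (simp add: card_PiE exp_of_nat_mult[symmetric])
  have "exp (1::real) \<ge> 2" using exp_ge_add_one_self[of 1] by simp
  then have "(2::real) ^ ((m + 1) * ?s) \<le> exp 1 ^ ((m + 1) * ?s)" by (intro power_mono) auto
  also have "\<dots> = exp (real ((m + 1) * ?s))" by (simp only: exp_of_nat_mult[symmetric] mult_1_right)
  finally have 2: "(2::real) ^ ((m + 1) * ?s) \<le> exp (real ((m + 1) * ?s))" .
  have 3: "(12::real) \<le> exp 12" using exp_ge_add_one_self[of 12] by linarith
  have "real (card ({..<m} \<rightarrow>\<^sub>E {..<m})) * 2 ^ ((m + 1) * ?s) * 12
      \<le> exp (real (m * m)) * exp (real ((m + 1) * ?s)) * exp 12"
    using 1 2 3 by (intro mult_mono) auto
  also have "\<dots> = exp (2 * real (pair_sample N) * (1 / (2 * N))\<^sup>2)"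
    unfolding e by (simp only: exp_add)
  finally have "real (card ({..<m} \<rightarrow>\<^sub>E {..<m})) * 2 ^ ((m + 1) * ?s) * 12
      * exp (- (2 * real (pair_sample N) * (1 / (2 * N))\<^sup>2)) \<le> 1"
    by (simp add: exp_minus field_simps)
  then show ?thesis unfolding power_mult[symmetric] of_nat_mult of_nat_power of_nat_numeral
    by (simp only: mult_minus_left)
qed

text \<open>The error budget uses \<open>\<gamma> = 1 / N\<close> and
  \<open>\<eta> = 1 / (2 * N)\<close>. After halving, the upper side adds \<open>3 / (4 * N)\<close>
  to the \<open>1 / (4 * N)\<close> from compression, and the lower side loses only
  \<open>1 / (4 * N)\<close>.\<close>

lemma estimator_approx:
  assumes E: "simple_graph n E" and n: "n > 0" and N: "N \<ge> 1"
  shows "measure_pmf.prob (samples_pmf N n)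
    {(x, w). \<bar>estimator N x w (adjacent E) - dist_chordal n E\<bar> \<le> 1 / N} \<ge> 2 / 3"
proof -
  let ?m = "skel_size N"
  let ?\<Theta> = "{..<?m} \<rightarrow>\<^sub>E {..<?m}"
  let ?C = "edge_cost (adjacent E)"
  let ?cell = "\<lambda>v. v mod num_parts N"
  have Npos: "real N > 0" using N by simp
  have mpos: "?m > 0" using N by (simp add: skel_size_def)
  have sizes: "num_parts N > 0" "part_sample N > 0" "pair_sample N > 0"
    using N by (auto simp: num_parts_def part_sample_def pair_sample_def)
  interpret assignment_family "{..<n}" ?\<Theta> "types ?m" ?C ?cell "part_sample N" "num_parts N"
    "pair_sample N" "2 ^ (?m + 1)"
  proof (rule assignment_family.intro)
    fix p
    show "assignment_cost {..<n} (types ?m p) ?C ?cell (part_sample N) (num_parts N)"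
    proof (rule assignment_cost.intro)
      show "{..<n} \<noteq> {}" using n by (simp add: lessThan_empty_iff)
      show "0 \<le> ?C u v k l" "?C u v k l \<le> 1" "?C u u k l = 0" for u v k l
        by (simp_all add: edge_cost_def)
      show "?C u v k l = ?C v u l k" for u v k l
        using conflict_commute[of k l] by (auto simp: edge_cost_def adjacent_def insert_commute)
      show "v mod num_parts N < num_parts N" for v using sizes(1) by simp
      show "num_parts N * card {(u, v). u \<in> {..<n} \<and> v \<in> {..<n} \<and> u \<noteq> v \<and> u mod num_parts N = v mod num_parts N}
          \<le> (card {..<n})\<^sup>2" by (rule card_same_residue[OF sizes(1)])
    qed (use sizes in \<open>simp_all add: finite_types types_nonempty\<close>)
    show "finite ?\<Theta>" by (simp add: finite_PiE)
    show "?\<Theta> \<noteq> {}" using mpos by (simp add: PiE_eq_empty_iff lessThan_empty_iff)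
    show "card (types ?m p) \<le> 2 ^ (?m + 1)" by (rule card_types)
    show "pair_sample N > 0" by (rule sizes(3))
  qed
  have cost: "total_cost \<sigma> = card (conflicts n E \<sigma>)" for \<sigma>
  proof -
    have "total_cost \<sigma> = (\<Sum>u<n. \<Sum>v<n. of_bool ((u, v) \<in> conflicts n E \<sigma>))"
      unfolding total_cost_def by (intro sum.cong refl) (auto simp: edge_cost_def conflicts_def adjacent_def)
    also have "\<dots> = (\<Sum>z\<in>{..<n} \<times> {..<n}. of_bool (z \<in> conflicts n E \<sigma>))"
      unfolding sum.cartesian_product by (intro sum.cong refl) auto
    also have "\<dots> = real (card (({..<n} \<times> {..<n}) \<inter> conflicts n E \<sigma>))" by simp
    also have "({..<n} \<times> {..<n}) \<inter> conflicts n E \<sigma> = conflicts n E \<sigma>" by (auto simp: conflicts_def)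
    finally show ?thesis .
  qed
  have m: "8 * N * (8 * N + 1)\<^sup>2 \<le> ?m" by (simp add: skel_size_def)
  have "8 * N > 0" using N by simp
  then obtain p \<sigma> where p: "p \<in> ?\<Theta>" and \<sigma>: "\<forall>v. \<sigma> v \<in> types ?m p"
    and near: "card (conflicts n E \<sigma>) / real n ^ 2 / 2 \<le> dist_chordal n E + 2 / (8 * N)"
    using dist_chordal_ge[OF E n _ m] by auto
  have "2 / 3 \<le> measure_pmf.prob (samples_pmf N n)
      {(x, w). (\<exists>\<theta>\<in>?\<Theta>. \<exists>\<tau>. (\<forall>v. \<tau> v \<in> types ?m \<theta>) \<and> total_cost \<tau> / (card {..<n})\<^sup>2 - 1 / (2 * N) < min_emp x w) \<and>
         min_emp x w < total_cost \<sigma> / (card {..<n})\<^sup>2 + 1 / N + 1 / (2 * N)}"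
    unfolding samples_pmf_def
  proof (rule min_empirical_approx[where \<delta> = "1 / (96 * N)", OF p])
    \<comment> \<open>Estimation errors and pairs inside cells contribute at most 1/12 each.\<close>
    show "(2 * (2 * (1 / (96 * N)) + real (2 ^ (?m + 1)) * (2 * exp (- 2 * real (part_sample N) * (1 / (96 * N))\<^sup>2)))
        + 3 / real (num_parts N)) / (1 / N) \<le> 1 / 6"
    proof -
      have "3 / real (num_parts N) = 1 / (12 * real N)" by (simp add: num_parts_def)
      then show ?thesis using part_sample_bound[OF N] Npos by (simp add: field_simps)
    qed
    show "real (card ?\<Theta> * (2 ^ (?m + 1)) ^ (part_sample N * num_parts N))
        * (2 * exp (- 2 * real (pair_sample N) * (1 / (2 * N))\<^sup>2)) \<le> 1 / 6"
      by (rule pair_sample_bound[OF N])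
  qed (use \<sigma> Npos in auto)
  also have "\<dots> \<le> measure_pmf.prob (samples_pmf N n)
    {(x, w). \<bar>estimator N x w (adjacent E) - dist_chordal n E\<bar> \<le> 1 / N}"
  proof (rule measure_pmf.finite_measure_mono)
    have "\<bar>estimator N x w (adjacent E) - dist_chordal n E\<bar> \<le> 1 / N"
      if \<tau>: "\<And>v. \<tau> v \<in> types ?m \<theta>" and lo: "total_cost \<tau> / (card {..<n})\<^sup>2 - 1 / (2 * N) < min_emp x w"
        and hi: "min_emp x w < total_cost \<sigma> / (card {..<n})\<^sup>2 + 1 / N + 1 / (2 * N)" for x w \<theta> \<tau>
    proof -
      have est: "estimator N x w (adjacent E) = min_emp x w / 2" by (simp add: estimator_def)
      have fractions: "1 / real (2 * N) = 1 / real N / 2" "1 / (2 * real N) = 1 / real N / 2" "2 / real (8 * N) = 1 / real N / 4"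
        by simp_all
      have h: "1 / real N > 0" using Npos by simp
      have close: "\<bar>M / 2 - D\<bar> \<le> h" if "D \<le> T / 2" "S / 2 \<le> D + h / 4" "T - h / 2 < M" "M < S + h + h / 2" "h > 0"
        for D T S M h :: real using that by linarith
      have "dist_chordal n E \<le> total_cost \<tau> / (card {..<n})\<^sup>2 / 2"
        using dist_chordal_le[OF E, of \<tau> ?m \<theta>] \<tau> by (simp add: cost)
      moreover have "total_cost \<sigma> / (card {..<n})\<^sup>2 / 2 \<le> dist_chordal n E + 1 / real N / 4"
        using near unfolding fractions by (simp add: cost)
      ultimately show ?thesis
        using lo hi h unfolding est fractions by (rule close)
    qed
    then show "{(x, w). (\<exists>\<theta>\<in>?\<Theta>. \<exists>\<tau>. (\<forall>v. \<tau> v \<in> types ?m \<theta>) \<and> total_cost \<tau> / (card {..<n})\<^sup>2 - 1 / (2 * N) < min_emp x w) \<and>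
         min_emp x w < total_cost \<sigma> / (card {..<n})\<^sup>2 + 1 / N + 1 / (2 * N)}
      \<subseteq> {(x, w). \<bar>estimator N x w (adjacent E) - dist_chordal n E\<bar> \<le> 1 / N}" by blast
  qed simp
  finally show ?thesis .
qed

section \<open>Queries and the algorithm\<close>

definition sampled_vertices :: "nat \<Rightarrow> (nat \<Rightarrow> nat \<Rightarrow> nat) \<Rightarrow> (nat \<Rightarrow> nat \<times> nat) \<Rightarrow> nat list" where
  "sampled_vertices N x w = map (\<lambda>(i, j). x i j) (List.product [0..<num_parts N] [0..<part_sample N])
     @ map (\<lambda>l. fst (w l)) [0..<pair_sample N] @ map (\<lambda>l. snd (w l)) [0..<pair_sample N]"

text \<open>The list is fixed before any answer arrives, so the algorithm is non-adaptive.\<close>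

definition queries :: "nat \<Rightarrow> (nat \<Rightarrow> nat \<Rightarrow> nat) \<Rightarrow> (nat \<Rightarrow> nat \<times> nat) \<Rightarrow> (nat \<times> nat) list" where
  "queries N x w = List.product (sampled_vertices N x w) (sampled_vertices N x w)"

definition query_count :: "nat \<Rightarrow> nat" where
  "query_count N = (num_parts N * part_sample N + 2 * pair_sample N)\<^sup>2"

lemma length_queries: "length (queries N x w) = query_count N"
  by (simp add: queries_def sampled_vertices_def query_count_def power2_eq_square mult_2)

text \<open>The empirical cost looks at sampled pairs only, and the greedy type of a sampled vertex
  depends only on its adjacency to samples.\<close>

lemma estimator_cong:
  assumes "N \<ge> 1" and agree: "\<And>u v. (u, v) \<in> set (queries N x w) \<Longrightarrow> a u v = a' u v"
  shows "estimator N x w a = estimator N x w a'"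
proof -
  let ?S = "set (sampled_vertices N x w)"
  let ?q = "part_sample N" and ?cell = "\<lambda>v. v mod num_parts N"
  have agree': "edge_cost a u v = edge_cost a' u v" if "u \<in> ?S" "v \<in> ?S" for u v
    using agree[of u v] that by (simp add: queries_def edge_cost_def fun_eq_iff)
  have x: "x i j \<in> ?S" if "i < num_parts N" "j < ?q" for i j
    using that by (force simp: sampled_vertices_def)
  have w: "fst (w l) \<in> ?S" "snd (w l) \<in> ?S" if "l < pair_sample N" for l
    using that by (auto simp: sampled_vertices_def)
  have cand: "candidate (edge_cost a) K ?cell ?q x \<pi> v = candidate (edge_cost a') K ?cell ?q x \<pi> v"
    if v: "v \<in> ?S" for K \<pi> v
  proof -
    have "?cell v < num_parts N" using assms(1) by (simp add: num_parts_def)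
    then have "estimate (edge_cost a) ?q (x (?cell v)) (\<pi> (?cell v)) v = estimate (edge_cost a') ?q (x (?cell v)) (\<pi> (?cell v)) v"
      using agree'[OF v] x unfolding estimate_def by (intro ext arg_cong2[where f = "(/)"] sum.cong refl) simp
    then show ?thesis by (simp add: candidate_def greedy_def)
  qed
  have "empirical (edge_cost a) (pair_sample N) w (candidate (edge_cost a) K ?cell ?q x \<pi>)
      = empirical (edge_cost a') (pair_sample N) w (candidate (edge_cost a') K ?cell ?q x \<pi>)" for K \<pi>
    unfolding empirical_def
    by (intro arg_cong2[where f = "(/)"] sum.cong refl) (simp add: agree' w cand)
  then show ?thesis by (simp add: estimator_def min_empirical_def)
qed

text \<open>The case \<open>n = 0\<close> is separate because there is no vertex to sample. Rounding
  up makes the accuracy \<open>1 / N\<close> at most \<open>\<epsilon>\<close>.\<close>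

definition chordality_estimation :: randomized_algorithm where
  "chordality_estimation \<epsilon> n = (if n = 0 then return_pmf (Output 0) else
     let N = nat \<lceil>1 / \<epsilon>\<rceil> in
       map_pmf (\<lambda>(x, w). ask (queries N x w) (estimator N x w) (\<lambda>_ _. False)) (samples_pmf N n))"

lemma poly_bounded_query_count: "poly_bounded query_count"
  unfolding query_count_def pair_sample_def part_sample_def num_parts_def skel_size_def power2_eq_square
  by (intro poly_bounded_add poly_bounded_mult poly_bounded_const poly_bounded_id)

text \<open>Division by zero yields zero, so any two graphs on no vertices have distance 0; the
  hypotheses make the minimum range over a nonempty set.\<close>

lemma dist_to_property_0: "dist_to_property 0 E P = 0"
  if "simple_graph 0 E'" "P 0 E'"
proof -
  have "graph_dist 0 E ` {E'. simple_graph 0 E' \<and> P 0 E'} = {0}"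
    using that by (auto simp: graph_dist_def)
  then show ?thesis by (simp add: dist_to_property_def)
qed

theorem theorem1p6:
  "\<exists>(A :: randomized_algorithm) (p :: real poly).
     distance_approximation_algorithm (\<lambda>n E. chordal E) A \<and>
     query_complexity_at_most A (\<lambda>\<epsilon>. poly p (1 / \<epsilon>))"
proof -
  have N: "nat \<lceil>1 / \<epsilon>\<rceil> \<ge> 1" "1 / real (nat \<lceil>1 / \<epsilon>\<rceil>) \<le> \<epsilon>" "real (nat \<lceil>1 / \<epsilon>\<rceil>) \<le> 2 * (1 / \<epsilon>)"
    if "0 < \<epsilon>" "\<epsilon> < 1" for \<epsilon> :: real
  proof -
    have gt: "1 / \<epsilon> > 1" using that by simp
    then have ge: "real (nat \<lceil>1 / \<epsilon>\<rceil>) \<ge> 1 / \<epsilon>" by linarith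
    then show "nat \<lceil>1 / \<epsilon>\<rceil> \<ge> 1" using gt by linarith
    show "1 / real (nat \<lceil>1 / \<epsilon>\<rceil>) \<le> \<epsilon>"
      using divide_left_mono[OF ge, of 1] that gt ge by simp
    show "real (nat \<lceil>1 / \<epsilon>\<rceil>) \<le> 2 * (1 / \<epsilon>)" using gt by linarith
  qed
  obtain c d where cd: "\<And>N. N \<ge> 1 \<Longrightarrow> query_count N \<le> c * N ^ d"
    using poly_bounded_query_count unfolding poly_bounded_def by blast
  have "distance_approximation_algorithm (\<lambda>n E. chordal E) chordality_estimation"
    unfolding distance_approximation_algorithm_def
  proof (intro allI impI, elim conjE)
    fix n E and \<epsilon> :: real
    assume E: "simple_graph n E" and \<epsilon>: "0 < \<epsilon>" "\<epsilon> < 1"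
    let ?N = "nat \<lceil>1 / \<epsilon>\<rceil>"
    let ?good = "{t. \<bar>run (adjacent E) t - dist_chordal n E\<bar> \<le> \<epsilon>}"
    show "2 / 3 \<le> measure_pmf.prob (chordality_estimation \<epsilon> n) ?good"
    proof (cases "n = 0")
      case True
      have "dist_chordal 0 E = 0"
        by (rule dist_to_property_0[of "{}"]) (auto simp: simple_graph_def chordal_def is_cycle_def)
      then show ?thesis using True \<epsilon> by (simp add: chordality_estimation_def)
    next
      case False
      have run: "run (adjacent E) (ask (queries ?N x w) (estimator ?N x w) (\<lambda>_ _. False)) = estimator ?N x w (adjacent E)" for x w
        unfolding run_ask by (rule estimator_cong[OF N(1)[OF \<epsilon>]]) simp
      have "2 / 3 \<le> measure_pmf.prob (samples_pmf ?N n)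
          {(x, w). \<bar>estimator ?N x w (adjacent E) - dist_chordal n E\<bar> \<le> 1 / ?N}"
        using False by (intro estimator_approx E N(1) \<epsilon>) simp
      also have "\<dots> \<le> measure_pmf.prob (samples_pmf ?N n)
          {(x, w). \<bar>estimator ?N x w (adjacent E) - dist_chordal n E\<bar> \<le> \<epsilon>}"
        using N(2)[OF \<epsilon>] by (intro measure_pmf.finite_measure_mono) auto
      also have "\<dots> = measure_pmf.prob (chordality_estimation \<epsilon> n) ?good"
        using False by (simp add: chordality_estimation_def Let_def vimage_def case_prod_unfold run)
      finally show ?thesis .
    qed
  qed
  \<comment> \<open>The factor \<open>2 ^ d\<close> comes from
    \<open>nat \<lceil>1 / \<epsilon>\<rceil> \<le> 2 / \<epsilon>\<close>, which holds because
    \<open>1 / \<epsilon>\<close> exceeds 1.\<close>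
  moreover have "query_complexity_at_most chordality_estimation (\<lambda>\<epsilon>. poly (monom (c * 2 ^ d) d) (1 / \<epsilon>))"
    unfolding query_complexity_at_most_def
  proof (intro allI impI ballI, elim conjE)
    fix n E t and \<epsilon> :: real
    assume \<epsilon>: "0 < \<epsilon>" "\<epsilon> < 1" and t: "t \<in> set_pmf (chordality_estimation \<epsilon> n)"
    let ?N = "nat \<lceil>1 / \<epsilon>\<rceil>"
    have "num_queries (adjacent E) t \<le> query_count ?N"
      using t by (auto simp: chordality_estimation_def Let_def num_queries_ask length_queries split: if_splits)
    also have "\<dots> \<le> c * ?N ^ d" by (rule cd[OF N(1)[OF \<epsilon>]])
    finally have "real (num_queries (adjacent E) t) \<le> real c * real ?N ^ d"
      by (metis of_nat_le_iff of_nat_mult of_nat_power)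
    also have "\<dots> \<le> real c * (2 * (1 / \<epsilon>)) ^ d"
      using N(3)[OF \<epsilon>] by (intro mult_left_mono power_mono) auto
    also have "\<dots> = poly (monom (c * 2 ^ d) d) (1 / \<epsilon>)"
      by (simp add: poly_monom power_mult_distrib power_divide)
    finally show "real (num_queries (adjacent E) t) \<le> poly (monom (c * 2 ^ d) d) (1 / \<epsilon>)" .
  qed
  ultimately show ?thesis by blast
qed

end
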